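(* Let $r\ge3$. As a power series in $t$ with coefficients in $\mathcal{O}'$, $$h=h'^{\,q}\,t\,\Pi(1)(t)^{-1}+o(t^N),\qquad N=(q-1)(q^{2r-1}-q^r)+1,$$ where $\Pi(1)(t)=S_T(t)^q-S_T(t)W(t)^{q-1}$ with $$S_T(t)=1+\frac{g'_{r-2}}{\Delta'}t^{q^{r-1}-q^{r-2}}+\frac{g'_{r-3}}{\Delta'}t^{q^{r-1}-q^{r-3}}+\dots+\frac{g'_1}{\Delta'}t^{q^{r-1}-q}+\frac{T}{\Delta'}t^{q^{r-1}-1},\qquad W(t)=\Delta'^{-1}t^{q^{r-1}-1},$$ and $\Pi(1)(t)^{-1}=1-U+U^2-\dots$ with $U=\Pi(1)(t)-1$.
   Context: $\mathbb{F}=\mathbb{F}_q$, $A=\mathbb{F}[T]$, $K_\infty=\mathbb{F}((T^{-1}))$, $C_\infty$ the completed algebraic closure of $K_\infty$. $\Omega^\rho=\{(\omega_1,\dots,\omega_\rho)\in C_\infty^\rho: K_\infty\text{-linearly independent},\ \omega_\rho=1\}$; fix $r\ge3$, write $\boldsymbol\omega=(\omega_1,\boldsymbol\omega')\in\Omega^r$, $\boldsymbol\omega'\in\Omega^{r-1}$; $\mathcal{O}'$ = ring of holomorphic functions on $\Omega^{r-1}$. For an $A$-lattice $\Lambda$ of rank $\rho$, $e^\Lambda(z)=z\prod_{0\ne\lambda\in\Lambda}(1-z/\lambda)$, $\phi^\Lambda_a(e^\Lambda(z))=e^\Lambda(az)$, $\phi^\Lambda_T(X)=TX+g_1(\Lambda)X^q+\dots+g_\rho(\Lambda)X^{q^\rho}$,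 $\Delta(\Lambda)=g_\rho(\Lambda)$. With $\Lambda'=\sum_{i=2}^rA\omega_i$: $g'_i=g_i(\Lambda')$, $\Delta'=g'_{r-1}$, $\phi'=\phi^{\Lambda'}$, and $t(\boldsymbol\omega)=e^{\Lambda'}(\omega_1)^{-1}$. For $a$ monic of degree $d\ge1$, $\phi'_a(X)=aX+\dots+\Delta'_{(d)}X^{q^{(r-1)d}}$ with $\Delta'_{(d)}=\Delta'^{(q^{(r-1)d}-1)/(q^{r-1}-1)}$, and $S_a(X)=\Delta'^{-1}_{(d)}X^{q^{(r-1)d}}\phi'_a(X^{-1})$. The function $h$ on $\Omega^r$ is the modular form of weight $(q^r-1)/(q-1)$ and type $1$ with $h^{q-1}=(-1)^{r-1}\Delta$ (where $\Delta(\boldsymbol\omega)=\Delta(\sum_{i=1}^rA\omega_i)$), normalized so that $h=h'^{\,q}\,t\prod_{a\in A\text{ monic}}S_a(t)^{q^r-1}$, where $h'$ is the corresponding function of rank $r-1$ on $\Omega^{r-1}$ (a $(q-1)$-th root of $(-1)^{r-2}\Delta'$). $P=Q+o(t^N)$ means the coefficients of $t^n$ in $P-Q$ vanish for all $n<N$. *)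

theory Defs
  imports
    Complex_Main
    "HOL-Library.Cardinality"
    "HOL-Computational_Algebra.Formal_Laurent_Series"
    "Jordan_Normal_Form.Determinant"
begin

text \<open>
  Conventions. The finite field is a type \<open>'f\<close> with \<open>q = CARD('f)\<close>; \<open>A\<close> is \<open>'f poly\<close>;
  \<open>K\<^sub>\<infinity> = F((T\<^sup>-\<^sup>1))\<close> is \<open>'f fls\<close>, whose uniformizer \<open>fls_X\<close> plays the role of \<open>1/T\<close>,
  so that \<open>T\<close> is \<open>fls_X_inv\<close>. A point \<open>(\<omega>\<^sub>1, \<dots>, \<omega>\<^sub>\<rho>)\<close> is a list of length \<open>\<rho>\<close>;
  \<open>\<omega>\<^sub>i\<close> is \<open>ws ! (i - 1)\<close>, and \<open>(\<omega>\<^sub>1, \<omega>')\<close> is \<open>w # ws\<close>.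
\<close>

definition K_abs :: "'f::{finite,field} fls \<Rightarrow> real" where
  "K_abs x = (if x = 0 then 0 else real CARD('f) powi (- fls_subdegree x))"

definition C_abs :: "'c::{zero,metric_space} \<Rightarrow> real" where
  "C_abs x = dist x 0"

text \<open>
  \<open>C\<^sub>\<infinity>\<close> is characterized, up to isomorphism over \<open>K\<^sub>\<infinity>\<close>, as a complete algebraically closed
  valued field containing \<open>K\<^sub>\<infinity>\<close> isometrically, in which the elements algebraic over \<open>K\<^sub>\<infinity>\<close>
  are dense.
\<close>

locale completed_algebraic_closure =
  fixes \<iota> :: "'f::{finite,field} fls \<Rightarrow> 'c::{alg_closed_field,complete_space}"
  assumes \<iota>_one: "\<iota> 1 = 1"
    and \<iota>_add: "\<iota> (x + y) = \<iota> x + \<iota> y"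
    and \<iota>_mult: "\<iota> (x * y) = \<iota> x * \<iota> y"
    and dist_eq_abs: "dist u v = C_abs (u - v)"
    and abs_mult: "C_abs (u * v) = C_abs u * C_abs v"
    and abs_ultrametric: "C_abs (u + v) \<le> max (C_abs u) (C_abs v)"
    and abs_\<iota>: "C_abs (\<iota> x) = K_abs x"
    and algebraic_dense:
      "0 < \<epsilon> \<Longrightarrow> \<exists>v. (\<exists>p. p \<noteq> 0 \<and> poly (map_poly \<iota> p) v = 0) \<and> dist u v < \<epsilon>"

definition A_emb :: "('f::{finite,field} fls \<Rightarrow> 'c) \<Rightarrow> 'f poly \<Rightarrow> 'c" where
  "A_emb \<iota> a = \<iota> (poly (map_poly fls_const a) fls_X_inv)"

subsection \<open>The Drinfeld symmetric space and its holomorphic functions\<close>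

definition Omega :: "('f::{finite,field} fls \<Rightarrow> 'c::field) \<Rightarrow> nat \<Rightarrow> 'c list set" where
  "Omega \<iota> \<rho> = {ws. length ws = \<rho> \<and> 0 < \<rho> \<and> last ws = 1 \<and>
     (\<forall>c. (\<Sum>i<\<rho>. \<iota> (c i) * ws ! i) = 0 \<longrightarrow> (\<forall>i<\<rho>. c i = 0))}"

text \<open>
  The standard admissible covering of \<open>\<Omega>\<^sup>\<rho>\<close> by affinoids:
  \<open>\<bar>l(\<omega>)\<bar> \<ge> q\<^sup>-\<^sup>n max\<^sub>j \<bar>\<omega>\<^sub>j\<bar>\<close> for all unimodular linear forms \<open>l\<close> over \<open>K\<^sub>\<infinity>\<close>.
\<close>

definition Omega_aff ::
  "('f::{finite,field} fls \<Rightarrow> 'c::{field,metric_space}) \<Rightarrow> nat \<Rightarrow> nat \<Rightarrow> 'c list set" where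
  "Omega_aff \<iota> \<rho> n = {ws \<in> Omega \<iota> \<rho>. \<forall>c.
     (\<forall>i<\<rho>. K_abs (c i) \<le> 1) \<and> (\<exists>i<\<rho>. K_abs (c i) = 1) \<longrightarrow>
     (\<forall>j<\<rho>. C_abs (ws ! j) \<le> real CARD('f) ^ n * C_abs (\<Sum>i<\<rho>. \<iota> (c i) * ws ! i))}"

inductive_set polynomial_functions :: "nat \<Rightarrow> ('c::comm_ring_1 list \<Rightarrow> 'c) set" for \<rho> :: nat where
  const: "(\<lambda>_. c) \<in> polynomial_functions \<rho>"
| coord: "i < \<rho> \<Longrightarrow> (\<lambda>ws. ws ! i) \<in> polynomial_functions \<rho>"
| add: "f \<in> polynomial_functions \<rho> \<Longrightarrow> g \<in> polynomial_functions \<rho> \<Longrightarrow>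
    (\<lambda>ws. f ws + g ws) \<in> polynomial_functions \<rho>"
| mult: "f \<in> polynomial_functions \<rho> \<Longrightarrow> g \<in> polynomial_functions \<rho> \<Longrightarrow>
    (\<lambda>ws. f ws * g ws) \<in> polynomial_functions \<rho>"

text \<open>
  A function is holomorphic if its restriction to each affinoid of the covering is a uniform
  limit of rational functions without poles there.
\<close>

definition holomorphic_on_Omega ::
  "('f::{finite,field} fls \<Rightarrow> 'c::{field,metric_space}) \<Rightarrow> nat \<Rightarrow> ('c list \<Rightarrow> 'c) \<Rightarrow> bool" where
  "holomorphic_on_Omega \<iota> \<rho> f \<longleftrightarrow> (\<forall>n. \<forall>\<epsilon>>0.
     \<exists>u\<in>polynomial_functions \<rho>. \<exists>v\<in>polynomial_functions \<rho>.
       \<forall>ws\<in>Omega_aff \<iota> \<rho> n. v ws \<noteq> 0 \<and> dist (f ws) (u ws / v ws) < \<epsilon>)"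

subsection \<open>Lattices, exponential functions and Drinfeld modules\<close>

definition lattice :: "('f::{finite,field} fls \<Rightarrow> 'c::field) \<Rightarrow> 'c list \<Rightarrow> 'c set" where
  "lattice \<iota> ws = range (\<lambda>a. \<Sum>i<length ws. A_emb \<iota> (a i) * ws ! i)"

definition lattice_exp :: "'c::{field,metric_space} set \<Rightarrow> 'c \<Rightarrow> 'c" where
  "lattice_exp \<Lambda> z =
     Lim (finite_subsets_at_top (\<Lambda> - {0})) (\<lambda>F. z * (\<Prod>l\<in>F. 1 - z / l))"

definition drinfeld_module ::
  "('f::{finite,field} fls \<Rightarrow> 'c::{field,metric_space}) \<Rightarrow> 'c set \<Rightarrow> 'f poly \<Rightarrow> 'c poly" where
  "drinfeld_module \<iota> \<Lambda> a =
     (THE p. \<forall>z. poly p (lattice_exp \<Lambda> z) = lattice_exp \<Lambda> (A_emb \<iota> a * z))"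

definition g_coeff ::
  "('f::{finite,field} fls \<Rightarrow> 'c::{field,metric_space}) \<Rightarrow> nat \<Rightarrow> 'c list \<Rightarrow> 'c" where
  "g_coeff \<iota> i ws = coeff (drinfeld_module \<iota> (lattice \<iota> ws) [:0, 1:]) (CARD('f) ^ i)"

definition Discr ::
  "('f::{finite,field} fls \<Rightarrow> 'c::{field,metric_space}) \<Rightarrow> 'c list \<Rightarrow> 'c" where
  "Discr \<iota> ws = g_coeff \<iota> (length ws) ws"

text \<open>
  \<open>S\<^sub>a(X) = \<Delta>'\<^sub>(\<^sub>d\<^sub>)\<^sup>-\<^sup>1 X\<^sup>Q \<phi>'\<^sub>a(X\<^sup>-\<^sup>1)\<close> with \<open>Q = q\<^sup>(\<^sup>r\<^sup>-\<^sup>1\<^sup>)\<^sup>d = deg \<phi>'\<^sub>a\<close>, where \<open>ws\<close> is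
  the point \<open>\<omega>'\<close> and so \<open>length ws = r - 1\<close>. For \<open>a = 1\<close> it is the constant \<open>1\<close>.
\<close>

definition S_series ::
  "('f::{finite,field} fls \<Rightarrow> 'c::{field,metric_space}) \<Rightarrow> 'c list \<Rightarrow> 'f poly \<Rightarrow> 'c fps" where
  "S_series \<iota> ws a =
    (let q = CARD('f); \<rho> = length ws; Q = q ^ (\<rho> * degree a);
         \<Delta>d = Discr \<iota> ws ^ ((Q - 1) div (q ^ \<rho> - 1))
     in fps_const (inverse \<Delta>d) *
        (\<Sum>i\<le>Q. fps_const (coeff (drinfeld_module \<iota> (lattice \<iota> ws) a) i) * fps_X ^ (Q - i)))"

subsection \<open>Modular forms and their expansions at infinity\<close>

definition t_param ::
  "('f::{finite,field} fls \<Rightarrow> 'c::{field,metric_space}) \<Rightarrow> 'c list \<Rightarrow> 'c" where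
  "t_param \<iota> ws = inverse (lattice_exp (lattice \<iota> (tl ws)) (hd ws))"

text \<open>
  A power series over the holomorphic functions on \<open>\<Omega>\<^sup>\<rho>\<^sup>-\<^sup>1\<close> is encoded as the family \<open>P\<close> of its
  evaluations at the points of \<open>\<Omega>\<^sup>\<rho>\<^sup>-\<^sup>1\<close>. It is the expansion of \<open>f\<close> if it converges to \<open>f\<close> in a
  neighborhood of infinity, that is for \<open>\<bar>t\<bar>\<close> small, uniformly in \<open>\<omega>'\<close> on each affinoid.
\<close>

definition has_t_expansion ::
  "('f::{finite,field} fls \<Rightarrow> 'c::{field,metric_space}) \<Rightarrow> nat \<Rightarrow>
    ('c list \<Rightarrow> 'c) \<Rightarrow> ('c list \<Rightarrow> 'c fps) \<Rightarrow> bool" where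
  "has_t_expansion \<iota> \<rho> f P \<longleftrightarrow>
     (\<forall>n. holomorphic_on_Omega \<iota> (\<rho> - 1) (\<lambda>ws. fps_nth (P ws) n)) \<and>
     (\<forall>m. \<exists>\<epsilon>>0. \<forall>ws\<in>Omega_aff \<iota> (\<rho> - 1) m. \<forall>w.
        w # ws \<in> Omega \<iota> \<rho> \<and> C_abs (t_param \<iota> (w # ws)) < \<epsilon> \<longrightarrow>
        (\<lambda>n. fps_nth (P ws) n * t_param \<iota> (w # ws) ^ n) sums f (w # ws))"

definition GL_A :: "nat \<Rightarrow> 'f::{finite,field} poly mat set" where
  "GL_A \<rho> = {\<gamma> \<in> carrier_mat \<rho> \<rho>. invertible_mat \<gamma>}"

definition row_form ::
  "('f::{finite,field} fls \<Rightarrow> 'c::field) \<Rightarrow> 'f poly mat \<Rightarrow> 'c list \<Rightarrow> nat \<Rightarrow> 'c" where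
  "row_form \<iota> \<gamma> ws j = (\<Sum>i<length ws. A_emb \<iota> (\<gamma> $$ (j, i)) * ws ! i)"

definition aut_factor ::
  "('f::{finite,field} fls \<Rightarrow> 'c::field) \<Rightarrow> 'f poly mat \<Rightarrow> 'c list \<Rightarrow> 'c" where
  "aut_factor \<iota> \<gamma> ws = row_form \<iota> \<gamma> ws (length ws - 1)"

definition GL_action ::
  "('f::{finite,field} fls \<Rightarrow> 'c::field) \<Rightarrow> 'f poly mat \<Rightarrow> 'c list \<Rightarrow> 'c list" where
  "GL_action \<iota> \<gamma> ws =
     map (\<lambda>j. row_form \<iota> \<gamma> ws j / aut_factor \<iota> \<gamma> ws) [0..<length ws]"

text \<open>
  Modular forms for \<open>GL(\<rho>, A)\<close>, \<open>\<rho> \<ge> 2\<close>, of weight \<open>k\<close> and type \<open>m\<close>. There is only one cusp,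
  so holomorphy at infinity is the existence of an expansion without negative powers of \<open>t\<close>.
\<close>

definition modular_form ::
  "('f::{finite,field} fls \<Rightarrow> 'c::{field,metric_space}) \<Rightarrow> nat \<Rightarrow> nat \<Rightarrow> nat \<Rightarrow>
    ('c list \<Rightarrow> 'c) \<Rightarrow> bool" where
  "modular_form \<iota> \<rho> k m f \<longleftrightarrow>
     holomorphic_on_Omega \<iota> \<rho> f \<and>
     (\<forall>\<gamma>\<in>GL_A \<rho>. \<forall>ws\<in>Omega \<iota> \<rho>.
        f (GL_action \<iota> \<gamma> ws) =
          aut_factor \<iota> \<gamma> ws ^ k * inverse (A_emb \<iota> (det \<gamma>)) ^ m * f ws) \<and>
     (\<exists>P. has_t_expansion \<iota> \<rho> f P)"

end

theory Submission
  imports Defs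
begin

text \<open>
  The lattice \<open>\<Lambda>\<close> of a point of \<open>\<Omega>\<^sup>\<rho>\<close> is discrete, so its exponential \<open>e\<close> is a limit of the
  polynomials \<open>z \<Prod>(1 - z/v)\<close> over finite \<open>F\<^sub>q\<close>-subspaces. These are additive, and grouping the
  factors by cosets of \<open>T\<Lambda>\<close> in \<open>\<Lambda>\<close> yields \<open>e(Tz) = \<phi>\<^sub>T(e(z))\<close>, where \<open>\<phi>\<^sub>T\<close> involves only the
  powers \<open>X\<^bsup>q\<^sup>j\<^esup>\<close> and has degree \<open>q\<^sup>\<rho>\<close>. Hence \<open>S\<^sub>a = 1 + O(t\<^sup>m)\<close> with
  \<open>m = (q - 1) q\<^bsup>\<rho> deg a - 1\<^esup>\<close>, which is negligible for \<open>deg a \<ge> 3\<close> as \<open>r \<ge> 3\<close>. In degrees 1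
  and 2 the product over all monic \<open>a\<close> is evaluated by \<open>\<Prod>\<^sub>c (x + c y) = x\<^sup>q - x y\<^sup>q\<^sup>-\<^sup>1\<close>: degree 1
  gives \<open>\<Pi>(1)\<close>, degree 2 is negligible. Finally \<open>\<Pi>(1)\<^bsup>q\<^sup>r - 1\<^esup> = \<Pi>(1)\<^sup>-\<^sup>1 \<Pi>(1)\<^bsup>q\<^sup>r\<^esup>\<close>, and the last factor is \<open>1 + O(t\<^sup>N\<^sup>-\<^sup>1)\<close>.
\<close>

subsection \<open>Finite fields and \<open>q\<close>-polynomials\<close>

text \<open>With \<rho> = r - 1, the size of N comes from the linear term of \<phi>'_T: in \<Pi>(1)
  - 1 the part (S_T - 1)^q is divisible by t^((q-1) q^\<rho>), but W^(q-1) has only order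
  (q-1)(q^\<rho> - 1). Raising to the power q^r multiplies this by q^r and gives (q-1)(q^(2r-1) -
  q^r) = N - 1; the factor t in front of the product supplies the last 1. Degree 2 just fits: its
  weakest term has the same lower bound N - 1, and only after the product over all constant and
  linear coefficients is taken, since a single factor is merely known to be 1 + O(t^m) with m =
  (q-1) q^(2\<rho>-1).

  None of this can start from the definitions directly: \<open>lattice_exp\<close> is a
  \<open>Lim\<close> and \<open>drinfeld_module\<close> a \<open>THE\<close>, which carry no
  information before convergence and uniqueness are known. Discreteness of the lattice needs
  independence over \<open>K_\<infinity>\<close> and its completeness; independence over A would not
  suffice. At finite level the properties of the exponential are polynomial identities, proved by
  counting roots, so that the limits involve only sums, products and differences.\<close>

lemma power_card_eq_self:
  fixes x :: "'f::{finite,field}"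
  shows "x ^ CARD('f) = x"
proof (cases "x = 0")
  case False
  have card_pos: "CARD('f) > 0"
    by simp
  \<comment> \<open>Multiplication by \<open>x\<close> permutes the nonzero elements; their product
    is nonzero and cancels.\<close>
  have "x * (\<Prod>y\<in>UNIV-{0}. x * y) = x * x ^ (CARD('f) - 1) * \<Prod>(UNIV-{0})"
    by (simp add: prod.distrib mult_ac)
  also have "x * x ^ (CARD('f) - 1) = x ^ CARD('f)"
    using card_pos by (metis power_minus_mult mult.commute)
  also have "(\<Prod>y\<in>UNIV-{0}. x * y) = (\<Prod>y\<in>UNIV-{0}. y)"
    by (rule prod.reindex_bij_witness[of _ "\<lambda>y. y / x" "\<lambda>y. x * y"]) (use False in auto)
  finally show ?thesis
    by simp
qed auto

lemma two_le_card_field: "2 \<le> CARD('f::{finite,field})"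
proof -
  have "card {0, 1::'f} \<le> CARD('f)"
    by (rule card_mono) auto
  thus ?thesis by simp
qed

text \<open>Scalars enter through an explicit map, so that the same facts apply to the field
  \<open>'c\<close>, to polynomials over it and to power series over it. A domain suffices, because
  the proofs count roots.\<close>

locale scalar_hom =
  fixes \<sigma> :: "'f::{finite,field} \<Rightarrow> 'c::idom" and q :: nat
  assumes q_eq: "q = CARD('f)"
    and hom_add: "\<sigma> (x + y) = \<sigma> x + \<sigma> y"
    and hom_mult: "\<sigma> (x * y) = \<sigma> x * \<sigma> y"
    and hom_one: "\<sigma> 1 = 1"
begin

lemma q_ge2: "q \<ge> 2" unfolding q_eq by (rule two_le_card_field)

lemma q_pos [simp]: "0 < q" using q_ge2 by simp

lemma hom_zero [simp]: "\<sigma> 0 = 0"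
  using hom_add[of 0 0] by (metis add.right_neutral add_left_cancel)

lemma hom_uminus: "\<sigma> (- x) = - \<sigma> x"
  using hom_add[of x "- x"] by (simp add: eq_neg_iff_add_eq_0 add.commute)

lemma hom_diff: "\<sigma> (x - y) = \<sigma> x - \<sigma> y"
  using hom_add[of x "- y"] by (simp add: hom_uminus)

lemma hom_eq_0_iff [simp]: "\<sigma> x = 0 \<longleftrightarrow> x = 0"
proof
  assume "\<sigma> x = 0"
  show "x = 0"
  proof (rule ccontr)
    assume "x \<noteq> 0"
    then have "\<sigma> x * \<sigma> (inverse x) = 1"
      by (simp add: hom_mult[symmetric] hom_one)
    with \<open>\<sigma> x = 0\<close> show False by simp
  qed
qed simp

lemma hom_eq_iff [simp]: "\<sigma> x = \<sigma> y \<longleftrightarrow> x = y"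
  using hom_eq_0_iff[of "x - y"] by (simp add: hom_diff del: hom_eq_0_iff)

lemma hom_power: "\<sigma> (x ^ n) = \<sigma> x ^ n"
  by (induction n) (simp_all add: hom_mult hom_one)

lemma hom_power_q: "\<sigma> c ^ q = \<sigma> c"
  by (simp add: hom_power[symmetric] power_card_eq_self q_eq)

lemma card_scalar_multiples: "y \<noteq> 0 \<Longrightarrow> card (range (\<lambda>c. \<sigma> c * y)) = q"
  by (subst card_image) (auto simp: inj_on_def q_eq)

text \<open>
  In \<open>x\<close>, the difference of the two sides has degree less than \<open>q\<close> and the \<open>q\<close> roots \<open>\<sigma> c * y\<close>.
\<close>

lemma prod_diff_scalar_multiples:
  "(\<Prod>c\<in>UNIV. x - \<sigma> c * y) = x ^ q - x * y ^ (q - 1)"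
proof (cases "y = 0")
  case True
  with q_ge2 show ?thesis by (simp add: zero_power q_eq[symmetric])
next
  case False
  define p where "p = (\<Prod>c\<in>UNIV. [:- (\<sigma> c * y), 1:])"
  define r where "r = monom 1 q - monom (y ^ (q - 1)) 1"
  have deg_p: "degree p = q"
    unfolding p_def by (subst degree_prod_eq_sum_degree) (simp_all add: q_eq)
  have "lead_coeff p = 1"
    unfolding p_def by (simp add: lead_coeff_prod)
  have "p = r"
  proof (rule poly_eqI_degree_lead_coeff[where n = q and A = "range (\<lambda>c. \<sigma> c * y)"])
    show "coeff p q = coeff r q"
      using \<open>lead_coeff p = 1\<close> deg_p q_ge2 by (simp add: r_def)
    show "degree r \<le> q"
      unfolding r_def using q_ge2
      by (intro degree_diff_le order_trans[OF degree_monom_le]) auto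
    show "poly p z = poly r z" if z: "z \<in> range (\<lambda>c. \<sigma> c * y)" for z
    proof -
      obtain c where c: "z = \<sigma> c * y" using z by auto
      have "poly p z = 0"
        unfolding p_def by (auto simp: poly_prod c)
      moreover have "y ^ q = y * y ^ (q - 1)"
        using q_ge2 by (metis power_minus_mult mult.commute q_eq zero_less_card_finite)
      then have "poly r z = 0"
        by (simp add: r_def poly_monom c power_mult_distrib hom_power_q mult_ac)
      ultimately show ?thesis by simp
    qed
  qed (use False deg_p card_scalar_multiples in auto)
  from arg_cong[OF this, of "\<lambda>p. poly p x"] show ?thesis
    by (simp add: p_def r_def poly_prod poly_monom mult_ac)
qed

lemma prod_add_scalar_multiples:
  "(\<Prod>c\<in>UNIV. x + \<sigma> c * y) = x ^ q - x * y ^ (q - 1)"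
proof -
  have "(\<Prod>c\<in>UNIV. x + \<sigma> c * y) = (\<Prod>c\<in>UNIV. x - \<sigma> c * y)"
    by (rule prod.reindex_bij_witness[of _ uminus uminus]) (auto simp: hom_uminus)
  then show ?thesis by (simp add: prod_diff_scalar_multiples)
qed

text \<open>The same root count, which avoids showing that \<open>q\<close> is a power of the characteristic.\<close>

lemma power_q_add: "(x + y :: 'c) ^ q = x ^ q + y ^ q"
proof (cases "y = 0")
  case True
  with q_ge2 show ?thesis by (simp add: zero_power)
next
  case False
  define p where "p = [:y, 1:] ^ q"
  define r where "r = monom 1 q + [:y ^ q:]"
  have deg_p: "degree p = q"
    unfolding p_def by (simp add: degree_power_eq)
  have "lead_coeff p = 1"
    unfolding p_def by (simp add: lead_coeff_power)
  have "p = r"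
  proof (rule poly_eqI_degree_lead_coeff[where n = q and A = "range (\<lambda>c. \<sigma> c * y)"])
    show "coeff p q = coeff r q"
      using \<open>lead_coeff p = 1\<close> deg_p q_ge2 by (simp add: r_def coeff_pCons split: nat.split)
    show "degree r \<le> q"
      unfolding r_def by (intro degree_add_le order_trans[OF degree_monom_le]) auto
    show "poly p z = poly r z" if z: "z \<in> range (\<lambda>c. \<sigma> c * y)" for z
    proof -
      obtain c where c: "z = \<sigma> c * y" using z by auto
      have "poly p z = (\<sigma> (c + 1) * y) ^ q"
        by (simp add: p_def c hom_add hom_one algebra_simps)
      also have "\<dots> = \<sigma> (c + 1) * y ^ q"
        by (simp only: power_mult_distrib hom_power_q)
      also have "\<dots> = poly r z"
        by (simp add: r_def poly_monom c power_mult_distrib hom_power_q hom_add hom_one algebra_simps)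
      finally show ?thesis .
    qed
  qed (use False deg_p card_scalar_multiples in auto)
  from arg_cong[OF this, of "\<lambda>p. poly p x"] show ?thesis
    by (simp add: p_def r_def poly_monom add.commute)
qed

lemma power_q_power_add: "(x + y :: 'c) ^ (q ^ n) = x ^ (q ^ n) + y ^ (q ^ n)"
proof (induction n)
  case (Suc n)
  then show ?case
    by (metis power_Suc2 power_mult power_q_add)
qed simp

lemma power_q_uminus: "(- x :: 'c) ^ q = - (x ^ q)"
  using power_q_add[of x "- x"] q_ge2 by (simp add: zero_power eq_neg_iff_add_eq_0 add.commute)

lemma power_q_diff: "(x - y :: 'c) ^ q = x ^ q - y ^ q"
  using power_q_add[of x "- y"] by (simp add: power_q_uminus)

lemma power_q_power_sum: "(\<Sum>i\<in>I. f i :: 'c) ^ (q ^ n) = (\<Sum>i\<in>I. f i ^ (q ^ n))"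
proof (induction I rule: infinite_finite_induct)
  case (insert i I)
  then show ?case by (simp add: power_q_power_add)
qed (auto simp: zero_power)

lemma scalar_hom_poly: "scalar_hom (\<lambda>c. [:\<sigma> c:]) q"
  by unfold_locales (auto simp: q_eq hom_add hom_mult hom_one)

lemma scalar_hom_fps: "scalar_hom (\<lambda>c. fps_const (\<sigma> c)) q"
  by unfold_locales (auto simp: q_eq hom_add hom_mult hom_one)

text \<open>The exponents are recorded, and not just additivity of the induced function, because the
  estimates rest on the gap between the exponents q^n and q^(n-1).\<close>

definition qpoly :: "'c poly \<Rightarrow> bool" where
  "qpoly p \<longleftrightarrow> (\<forall>n. coeff p n \<noteq> 0 \<longrightarrow> n \<in> range (\<lambda>i. q ^ i))"

lemma qpoly_0 [simp]: "qpoly 0"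
  and qpoly_add: "qpoly p \<Longrightarrow> qpoly r \<Longrightarrow> qpoly (p + r)"
  and qpoly_diff: "qpoly p \<Longrightarrow> qpoly r \<Longrightarrow> qpoly (p - r)"
  and qpoly_smult: "qpoly p \<Longrightarrow> qpoly (Polynomial.smult c p)"
  unfolding qpoly_def by (auto, force, force)

lemma qpoly_monom: "qpoly (monom c (q ^ i))"
  by (auto simp: qpoly_def)

lemma qpoly_linear: "qpoly [:0, c:]"
  using qpoly_monom[of c 0] by (simp add: monom_altdef)

lemma qpoly_sum: "(\<And>i. i \<in> I \<Longrightarrow> qpoly (f i)) \<Longrightarrow> qpoly (\<Sum>i\<in>I. f i)"
  by (induction I rule: infinite_finite_induct) (auto intro: qpoly_add)

text \<open>The power q^n is additive in the polynomial ring too, so it acts term by term and moves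
  the exponent q^j to q^(j+n).\<close>

lemma qpoly_power_q_power:
  assumes "qpoly p"
  shows "qpoly (p ^ (q ^ n))"
proof -
  interpret P: scalar_hom "\<lambda>c. [:\<sigma> c:]" q by (rule scalar_hom_poly)
  have "p ^ (q ^ n) = (\<Sum>i\<le>degree p. monom (coeff p i) i) ^ (q ^ n)"
    by (simp add: poly_as_sum_of_monoms)
  also have "\<dots> = (\<Sum>i\<le>degree p. monom (coeff p i ^ (q ^ n)) (i * q ^ n))"
    by (simp add: P.power_q_power_sum monom_power mult.commute)
  also have "qpoly \<dots>"
  proof (rule qpoly_sum)
    fix i
    show "qpoly (monom (coeff p i ^ (q ^ n)) (i * q ^ n))"
    proof (cases "coeff p i = 0")
      case True
      then show ?thesis by (simp add: zero_power)
    next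
      case False
      with assms obtain j where "i = q ^ j"
        by (auto simp: qpoly_def)
      then show ?thesis
        using qpoly_monom[of "coeff p i ^ (q ^ n)" "j + n"] by (simp add: power_add)
    qed
  qed
  finally show ?thesis .
qed

lemma qpoly_pcompose:
  assumes "qpoly p" "qpoly r"
  shows "qpoly (pcompose p r)"
proof -
  have "pcompose p r = (\<Sum>i\<le>degree p. Polynomial.smult (coeff p i) (r ^ i))"
    by (simp add: pcompose_altdef poly_altdef coeff_map_poly degree_map_poly)
  also have "qpoly \<dots>"
  proof (rule qpoly_sum)
    fix i
    show "qpoly (Polynomial.smult (coeff p i) (r ^ i))"
    proof (cases "coeff p i = 0")
      case False
      with assms(1) obtain j where "i = q ^ j"
        by (auto simp: qpoly_def)
      then show ?thesis
        using assms(2) by (auto intro: qpoly_smult qpoly_power_q_power)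
    qed simp
  qed
  finally show ?thesis .
qed

end

subsection \<open>The absolute value and linear independence over \<open>K\<^sub>\<infinity>\<close>\<close>

text \<open>Closeness becomes agreement of Laurent coefficients, the form in which completeness is
  proved.\<close>

lemma K_abs_le_powi_iff:
  fixes x :: "'f::{finite,field} fls"
  shows "K_abs x \<le> real CARD('f) powi (- n) \<longleftrightarrow> (\<forall>k<n. fls_nth x k = 0)"
proof (cases "x = 0")
  case False
  have q: "1 < real CARD('f)" using two_le_card_field[where 'f='f] by linarith
  have "K_abs x \<le> real CARD('f) powi (- n) \<longleftrightarrow> n \<le> fls_subdegree x"
    using q False power_int_increasing[of "- fls_subdegree x" "- n" "real CARD('f)"]
      power_int_strict_increasing[of "- n" "- fls_subdegree x" "real CARD('f)"]
    by (cases "n \<le> fls_subdegree x") (auto simp: K_abs_def)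
  also have "\<dots> \<longleftrightarrow> (\<forall>k<n. fls_nth x k = 0)"
    using False by (auto intro: fls_subdegree_geI)
  finally show ?thesis .
qed (simp add: K_abs_def)

lemma K_complete:
  fixes x :: "nat \<Rightarrow> 'f::{finite,field} fls"
  assumes "\<And>n. K_abs (x (Suc n) - x n) \<le> real CARD('f) powi (- int n)"
  obtains L where "\<And>n. K_abs (L - x n) \<le> real CARD('f) powi (- int n)"
proof -
  have step: "fls_nth (x (Suc n)) k = fls_nth (x n) k" if "k < int n" for k n
    using assms[of n] that unfolding K_abs_le_powi_iff by simp
  have stable: "fls_nth (x m) k = fls_nth (x n) k" if "n \<le> m" "k < int n" for k m n
    using that by (induction m rule: dec_induct) (auto simp: step)
  \<comment> \<open>Coefficient \<open>k\<close> no longer changes from index \<open>k + 1\<close>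
    on. For negative \<open>k\<close> the index is cut off at 0, so below the subdegree of
    \<open>x 0\<close> everything vanishes and \<open>L\<close> is a Laurent series.\<close>
  define L where "L = Abs_fls (\<lambda>k. fls_nth (x (nat (k + 1))) k)"
  have nth_L: "fls_nth L k = fls_nth (x (nat (k + 1))) k" for k
    unfolding L_def
    by (rule nth_Abs_fls_lower_bound[of "min (-1) (fls_subdegree (x 0))"]) simp
  have "K_abs (L - x n) \<le> real CARD('f) powi (- int n)" for n
    unfolding K_abs_le_powi_iff
  proof (intro allI impI)
    fix k assume k: "k < int n"
    have "fls_nth L k = fls_nth (x n) k"
    proof (cases "k < 0")
      case True
      then have "fls_nth (x n) k = fls_nth (x 0) k" by (intro stable) auto
      with True show ?thesis by (simp add: nth_L)
    next
      case False
      with k show ?thesis by (auto simp: nth_L intro!: stable[symmetric])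
    qed
    then show "fls_nth (L - x n) k = 0" by simp
  qed
  with that show ?thesis by blast
qed

lemma finite_poly_degree_le: "finite {p :: 'f::{finite,zero} poly. degree p \<le> n}"
proof (rule finite_subset)
  show "{p :: 'f poly. degree p \<le> n} \<subseteq> Poly ` {xs. set xs \<subseteq> UNIV \<and> length xs \<le> Suc n}"
  proof
    fix p :: "'f poly" assume "p \<in> {p. degree p \<le> n}"
    then have "coeffs p \<in> {xs. set xs \<subseteq> UNIV \<and> length xs \<le> Suc n}"
      by (cases "p = 0") (auto simp: length_coeffs_degree)
    then show "p \<in> Poly ` {xs. set xs \<subseteq> UNIV \<and> length xs \<le> Suc n}"
      by (metis Poly_coeffs image_eqI)
  qed
  show "finite (Poly ` {xs :: 'f list. set xs \<subseteq> UNIV \<and> length xs \<le> Suc n})"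
    by (intro finite_imageI finite_lists_length_le) simp
qed

section \<open>The ultrametric absolute value and continuity of the field operations\<close>

context completed_algebraic_closure
begin

lemma abs_nonneg [simp]: "0 \<le> C_abs (u :: 'c)"
  and abs_eq_0_iff [simp]: "C_abs (u :: 'c) = 0 \<longleftrightarrow> u = 0"
  and abs_0 [simp]: "C_abs (0 :: 'c) = 0"
  by (auto simp: C_abs_def)

lemma abs_pos_iff [simp]: "0 < C_abs (u :: 'c) \<longleftrightarrow> u \<noteq> 0"
  by (simp add: C_abs_def)

lemma abs_1 [simp]: "C_abs (1 :: 'c) = 1"
proof -
  have "C_abs (1 :: 'c) * C_abs (1 :: 'c) = C_abs (1 :: 'c) * 1"
    by (simp flip: abs_mult)
  then show ?thesis by (metis abs_eq_0_iff mult_left_cancel zero_neq_one)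
qed

lemma abs_uminus [simp]: "C_abs (- u :: 'c) = C_abs u"
proof -
  have "C_abs (u - 0) = C_abs (0 - u)"
    by (metis dist_commute dist_eq_abs)
  then show ?thesis by simp
qed

lemma abs_diff_le: "C_abs (u - v :: 'c) \<le> max (C_abs u) (C_abs v)"
  using abs_ultrametric[of u "- v"] by simp

lemma abs_inverse: "C_abs (inverse u :: 'c) = inverse (C_abs u)"
proof (cases "u = 0")
  case False
  then have "C_abs u * C_abs (inverse u) = 1"
    by (simp flip: abs_mult)
  then show ?thesis by (metis inverse_unique)
qed simp

lemma abs_divide: "C_abs (u / v :: 'c) = C_abs u / C_abs v"
  by (simp add: divide_inverse abs_mult abs_inverse)

lemma abs_power: "C_abs (u ^ n :: 'c) = C_abs u ^ n"
  by (induction n) (simp_all add: abs_mult)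

lemma abs_prod: "C_abs (\<Prod>i\<in>I. f i :: 'c) = (\<Prod>i\<in>I. C_abs (f i))"
  by (induction I rule: infinite_finite_induct) (simp_all add: abs_mult)

lemma abs_sum_le:
  assumes "\<And>i. i \<in> I \<Longrightarrow> C_abs (f i :: 'c) \<le> B" "0 \<le> B"
  shows "C_abs (\<Sum>i\<in>I. f i) \<le> B"
  using assms
proof (induction I rule: infinite_finite_induct)
  case (insert i I)
  have "C_abs (f i + sum f I) \<le> max (C_abs (f i)) (C_abs (sum f I))"
    by (rule abs_ultrametric)
  also have "\<dots> \<le> B" using insert by auto
  finally show ?case using insert by simp
qed auto

lemma abs_add_eq:
  assumes "C_abs u < C_abs (v :: 'c)"
  shows "C_abs (u + v) = C_abs v"
proof (rule antisym)
  show "C_abs (u + v) \<le> C_abs v"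
    using abs_ultrametric[of u v] assms by simp
  have "C_abs v \<le> max (C_abs (u + v)) (C_abs u)"
    using abs_diff_le[of "u + v" u] by simp
  with assms show "C_abs v \<le> C_abs (u + v)" by simp
qed

lemma abs_one_minus_divide:
  assumes "C_abs z < C_abs (l :: 'c)"
  shows "C_abs (1 - z / l) = 1"
proof -
  have "l \<noteq> 0" using assms by (metis abs_0 abs_nonneg not_less)
  then have "C_abs (- (z / l)) < C_abs (1 :: 'c)"
    using assms by (simp add: abs_divide)
  from abs_add_eq[OF this] show ?thesis by simp
qed

lemma tendsto_iff_abs:
  "(f \<longlongrightarrow> (l :: 'c)) F \<longleftrightarrow> (\<forall>\<epsilon>>0. \<forall>\<^sub>F x in F. C_abs (f x - l) < \<epsilon>)"
  by (simp add: tendsto_iff dist_eq_abs)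

text \<open>The type gives a field and a metric; their compatibility is known through the absolute
  value of the locale, from which continuity has to be derived.\<close>

lemma C_tendsto_add:
  assumes "(f \<longlongrightarrow> (a :: 'c)) F" "(g \<longlongrightarrow> b) F"
  shows "((\<lambda>x. f x + g x) \<longlongrightarrow> a + b) F"
  unfolding tendsto_iff_abs
proof (intro allI impI)
  fix \<epsilon> :: real assume "\<epsilon> > 0"
  with assms have "\<forall>\<^sub>F x in F. C_abs (f x - a) < \<epsilon>" "\<forall>\<^sub>F x in F. C_abs (g x - b) < \<epsilon>"
    by (auto simp: tendsto_iff_abs)
  then show "\<forall>\<^sub>F x in F. C_abs (f x + g x - (a + b)) < \<epsilon>"
  proof eventually_elim
    case (elim x)
    have "f x + g x - (a + b) = (f x - a) + (g x - b)" by simp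
    with abs_ultrametric[of "f x - a" "g x - b"] elim show ?case
      by (metis max_less_iff_conj order_le_less_trans)
  qed
qed

lemma C_tendsto_mult:
  assumes "(f \<longlongrightarrow> (a :: 'c)) F" "(g \<longlongrightarrow> b) F"
  shows "((\<lambda>x. f x * g x) \<longlongrightarrow> a * b) F"
  unfolding tendsto_iff_abs
proof (intro allI impI)
  fix \<epsilon> :: real assume \<epsilon>: "\<epsilon> > 0"
  \<comment> \<open>The denominator keeps \<delta>, \<open>C_abs a * \<delta>\<close> and
    \<open>C_abs b * \<delta>\<close> below \<epsilon>, up to equality. By the ultrametric
    inequality the three terms need not share \<epsilon> among them.\<close>
  define \<delta> where "\<delta> = \<epsilon> / (1 + C_abs a + C_abs b)"
  have den: "0 < 1 + C_abs a + C_abs b"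
    by (simp add: add.assoc add_pos_nonneg)
  have \<delta>: "\<delta> > 0" unfolding \<delta>_def using \<epsilon> den by simp
  have bound: "y * \<delta> < \<epsilon>" if "y < 1 + C_abs a + C_abs b" for y
    using mult_strict_right_mono[OF that \<delta>] den by (simp add: \<delta>_def)
  have "\<forall>\<^sub>F x in F. C_abs (f x - a) < min \<delta> 1" "\<forall>\<^sub>F x in F. C_abs (g x - b) < min \<delta> 1"
    using assms \<delta> unfolding tendsto_iff_abs by (simp_all del: min_less_iff_conj)
  then show "\<forall>\<^sub>F x in F. C_abs (f x * g x - a * b) < \<epsilon>"
  proof eventually_elim
    case (elim x)
    have eq: "f x * g x - a * b = (f x - a) * (g x - b) + (a * (g x - b) + (f x - a) * b)"
      by (simp add: algebra_simps)
    have "C_abs ((f x - a) * (g x - b)) < \<epsilon>"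
    proof -
      have "C_abs ((f x - a) * (g x - b)) \<le> 1 * C_abs (g x - b)"
        unfolding abs_mult using elim by (intro mult_right_mono) auto
      also have "\<dots> < \<delta>" using elim by simp
      also have "\<delta> \<le> \<epsilon>" unfolding \<delta>_def using \<epsilon> den
        by (simp add: field_simps)
      finally show ?thesis .
    qed
    moreover have "C_abs (a * (g x - b)) < \<epsilon>"
    proof -
      have "C_abs (a * (g x - b)) \<le> C_abs a * \<delta>"
        unfolding abs_mult using elim by (intro mult_left_mono) auto
      also have "\<dots> < \<epsilon>" by (rule bound) (simp add: add_pos_nonneg)
      finally show ?thesis .
    qed
    moreover have "C_abs ((f x - a) * b) < \<epsilon>"
    proof -
      have "C_abs ((f x - a) * b) \<le> C_abs b * \<delta>"
        unfolding abs_mult using elim by (subst mult.commute) (intro mult_left_mono, auto)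
      also have "\<dots> < \<epsilon>" by (rule bound) (simp add: add_pos_nonneg)
      finally show ?thesis .
    qed
    ultimately show ?case
      unfolding eq
      using abs_ultrametric[of "(f x - a) * (g x - b)" "a * (g x - b) + (f x - a) * b"]
        abs_ultrametric[of "a * (g x - b)" "(f x - a) * b"] by linarith
  qed
qed

lemma C_tendsto_diff:
  assumes "(f \<longlongrightarrow> (a :: 'c)) F" "(g \<longlongrightarrow> b) F"
  shows "((\<lambda>x. f x - g x) \<longlongrightarrow> a - b) F"
  using C_tendsto_add[OF assms(1) C_tendsto_mult[OF tendsto_const[of "-1"] assms(2)]] by simp

lemma C_tendsto_prod:
  assumes "\<And>i. i \<in> I \<Longrightarrow> ((\<lambda>x. f x i) \<longlongrightarrow> (a i :: 'c)) F"
  shows "((\<lambda>x. \<Prod>i\<in>I. f x i) \<longlongrightarrow> (\<Prod>i\<in>I. a i)) F"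
  using assms by (induction I rule: infinite_finite_induct) (auto intro: C_tendsto_mult)

lemma C_tendsto_abs:
  assumes "(f \<longlongrightarrow> (a :: 'c)) F"
  shows "((\<lambda>x. C_abs (f x)) \<longlongrightarrow> C_abs a) F"
  unfolding C_abs_def by (intro tendsto_dist assms tendsto_const)

section \<open>Linear forms over \<open>K_\<infinity>\<close> are bounded below\<close>

lemma \<iota>_zero [simp]: "\<iota> 0 = 0"
  using \<iota>_add[of 0 0] by (metis add.right_neutral add_left_cancel)

lemma \<iota>_uminus: "\<iota> (- x) = - \<iota> x"
  using \<iota>_add[of x "- x"] by (simp add: eq_neg_iff_add_eq_0 add.commute)

lemma \<iota>_diff: "\<iota> (x - y) = \<iota> x - \<iota> y"
  using \<iota>_add[of x "- y"] by (simp add: \<iota>_uminus)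

lemma \<iota>_eq_0_iff [simp]: "\<iota> x = 0 \<longleftrightarrow> x = 0"
proof -
  have "\<iota> x = 0 \<longleftrightarrow> K_abs x = 0"
    by (simp flip: abs_\<iota>)
  also have "\<dots> \<longleftrightarrow> x = 0" by (simp add: K_abs_def)
  finally show ?thesis .
qed

lemma K_abs_nonneg: "0 \<le> K_abs (x :: 'f fls)"
  by (simp flip: abs_\<iota>)

lemma powi_minus_tendsto_0: "(\<lambda>n. B * real CARD('f) powi (- int n)) \<longlonglongrightarrow> 0"
proof -
  have "1 < real CARD('f)" using two_le_card_field[where 'f='f] by linarith
  then have "(\<lambda>n. B * inverse (real CARD('f)) ^ n) \<longlonglongrightarrow> B * 0"
    by (intro tendsto_mult tendsto_const LIMSEQ_power_zero) (simp add: inverse_less_1_iff)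
  then show ?thesis
    by (simp add: power_int_minus power_inverse)
qed

text \<open>
  If linear combinations of \<open>w 0, \<dots>, w (n - 1)\<close> came arbitrarily close to \<open>- w n\<close>, then by the
  induction hypothesis their coefficients would converge in \<open>K\<^sub>\<infinity>\<close>, to a relation between
  \<open>w 0, \<dots>, w n\<close>.
\<close>

lemma abs_linear_combination_ge:
  fixes w :: "nat \<Rightarrow> 'c"
  assumes "\<And>c. (\<Sum>i<n. \<iota> (c i) * w i) = 0 \<Longrightarrow> \<forall>i<n. c i = 0"
  shows "\<exists>\<delta>>0. \<forall>c. \<forall>i<n. \<delta> * K_abs (c i) \<le> C_abs (\<Sum>i<n. \<iota> (c i) * w i)"
  using assms
proof (induction n)
  case 0
  show ?case by (auto intro: exI[of _ 1])
next
  case (Suc n)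
  have indep: "\<forall>i<n. c i = 0" if "(\<Sum>i<n. \<iota> (c i) * w i) = 0" for c
  proof -
    have "(\<Sum>i<n. \<iota> ((c(n := 0)) i) * w i) = (\<Sum>i<n. \<iota> (c i) * w i)"
      by (intro sum.cong) auto
    with that have "(\<Sum>i<Suc n. \<iota> ((c(n := 0)) i) * w i) = 0"
      by simp
    from Suc.prems[OF this] show ?thesis by (metis fun_upd_other less_SucI nat_neq_iff)
  qed
  from Suc.IH[OF indep] obtain \<delta> where \<delta>: "\<delta> > 0"
    and IH: "\<And>c i. i < n \<Longrightarrow> \<delta> * K_abs (c i) \<le> C_abs (\<Sum>i<n. \<iota> (c i) * w i)"
    by blast
  have "\<exists>d>0. \<forall>c. d \<le> C_abs (w n + (\<Sum>i<n. \<iota> (c i) * w i))"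
  proof (rule ccontr)
    assume "\<not> ?thesis"
    then have ex: "\<exists>c. C_abs (w n + (\<Sum>i<n. \<iota> (c i) * w i)) < d" if "d > 0" for d
      using that by (auto simp: not_le)
    define Q where "Q m = real CARD('f) powi (- int m)" for m
    have Q_pos: "Q m > 0" for m by (simp add: Q_def)
    have Q_mono: "Q (Suc m) \<le> Q m" for m
      unfolding Q_def using two_le_card_field[where 'f='f]
      by (intro power_int_increasing) auto
    \<comment> \<open>The factor \<delta> compensates the constant of the induction hypothesis, so
      that successive coefficients differ by at most \<open>Q m\<close>, the rate required by
      \<open>K_complete\<close>.\<close>
    have "\<forall>m. \<exists>c. C_abs (w n + (\<Sum>i<n. \<iota> (c i) * w i)) < \<delta> * Q m"
      using ex \<delta> Q_pos by simp
    then obtain c where c: "\<And>m. C_abs (w n + (\<Sum>i<n. \<iota> (c m i) * w i)) < \<delta> * Q m"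
      by metis
    have "K_abs (c (Suc m) i - c m i) \<le> Q m" if "i < n" for m i
    proof -
      have "\<delta> * K_abs (c (Suc m) i - c m i) \<le> C_abs (\<Sum>i<n. \<iota> (c (Suc m) i - c m i) * w i)"
        using IH[of i "\<lambda>i. c (Suc m) i - c m i"] that by simp
      also have "(\<Sum>i<n. \<iota> (c (Suc m) i - c m i) * w i) =
          (w n + (\<Sum>i<n. \<iota> (c (Suc m) i) * w i)) - (w n + (\<Sum>i<n. \<iota> (c m i) * w i))"
        by (simp add: \<iota>_diff left_diff_distrib sum_subtractf)
      also have "C_abs \<dots> \<le> max (C_abs (w n + (\<Sum>i<n. \<iota> (c (Suc m) i) * w i)))
          (C_abs (w n + (\<Sum>i<n. \<iota> (c m i) * w i)))"
        by (rule abs_diff_le)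
      also have "\<dots> \<le> \<delta> * Q m"
        using c[of m] c[of "Suc m"] mult_left_mono[OF Q_mono[of m], of \<delta>] \<delta> by linarith
      finally show ?thesis using \<delta> by simp
    qed
    then have "\<exists>L. \<forall>m. K_abs (L - c m i) \<le> Q m" if "i < n" for i
      using K_complete[of "\<lambda>m. c m i"] that unfolding Q_def by blast
    then obtain L where L: "\<And>i m. i < n \<Longrightarrow> K_abs (L i - c m i) \<le> Q m"
      by metis
    define B where "B = \<delta> + (\<Sum>i<n. C_abs (w i))"
    have B: "\<delta> \<le> B" "\<And>i. i < n \<Longrightarrow> C_abs (w i) \<le> B"
      unfolding B_def using \<delta> by (auto intro!: sum_nonneg add_increasing member_le_sum)
    define s where "s = w n + (\<Sum>i<n. \<iota> (L i) * w i)"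
    have "C_abs s \<le> B * Q m" for m
    proof -
      have "s = (w n + (\<Sum>i<n. \<iota> (c m i) * w i)) + (\<Sum>i<n. \<iota> (L i - c m i) * w i)"
        by (simp add: s_def \<iota>_diff left_diff_distrib sum_subtractf)
      also have "C_abs \<dots> \<le> max (C_abs (w n + (\<Sum>i<n. \<iota> (c m i) * w i)))
          (C_abs (\<Sum>i<n. \<iota> (L i - c m i) * w i))"
        by (rule abs_ultrametric)
      also have "\<dots> \<le> B * Q m"
      proof (rule max.boundedI)
        show "C_abs (w n + (\<Sum>i<n. \<iota> (c m i) * w i)) \<le> B * Q m"
          using c[of m] mult_right_mono[OF B(1) less_imp_le[OF Q_pos[of m]]] by linarith
        show "C_abs (\<Sum>i<n. \<iota> (L i - c m i) * w i) \<le> B * Q m"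
        proof (rule abs_sum_le)
          fix i assume "i \<in> {..<n}"
          then have "K_abs (L i - c m i) * C_abs (w i) \<le> Q m * B"
            using L B Q_pos[of m] by (intro mult_mono) (auto intro: less_imp_le)
          then show "C_abs (\<iota> (L i - c m i) * w i) \<le> B * Q m"
            by (simp add: abs_mult abs_\<iota> mult.commute)
        qed (use B \<delta> Q_pos[of m] in auto)
      qed
      finally show ?thesis .
    qed
    then have "C_abs s \<le> 0"
      by (intro LIMSEQ_le_const[OF powi_minus_tendsto_0[of B]]) (auto simp: Q_def)
    then have "s = 0" using abs_nonneg[of s] by (metis abs_eq_0_iff antisym)
    moreover have "(\<Sum>i<n. \<iota> ((L(n := 1)) i) * w i) = (\<Sum>i<n. \<iota> (L i) * w i)"
      by (intro sum.cong) auto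
    ultimately have "(\<Sum>i<Suc n. \<iota> ((L(n := 1)) i) * w i) = 0"
      by (simp add: s_def \<iota>_one add.commute)
    from Suc.prems[OF this] have "(L(n := 1)) n = 0" by blast
    then show False by simp
  qed
  then obtain d where d: "d > 0" "\<And>c. d \<le> C_abs (w n + (\<Sum>i<n. \<iota> (c i) * w i))"
    by blast
  \<comment> \<open>From |c_n| \<le> |s| / d follows |c_n w_n| \<le> |s| |w_n| / d; the summand 1
    lets the same \<open>e\<close> dominate |s| itself.\<close>
  define e where "e = 1 + C_abs (w n) / d"
  have e: "e \<ge> 1" using d by (simp add: e_def)
  have last: "d * K_abs (c n) \<le> C_abs (\<Sum>i<Suc n. \<iota> (c i) * w i)" for c
  proof (cases "c n = 0")
    case True
    then show ?thesis by (simp add: K_abs_def)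
  next
    case False
    have "(\<Sum>i<Suc n. \<iota> (c i) * w i) = \<iota> (c n) * (w n + (\<Sum>i<n. \<iota> (c i / c n) * w i))"
      using False
      by (simp add: algebra_simps sum_distrib_left \<iota>_mult[symmetric] mult.assoc[symmetric])
    then have "C_abs (\<Sum>i<Suc n. \<iota> (c i) * w i) =
        C_abs (w n + (\<Sum>i<n. \<iota> (c i / c n) * w i)) * K_abs (c n)"
      by (simp only: abs_mult abs_\<iota> mult.commute)
    with mult_right_mono[OF d(2) K_abs_nonneg] show ?thesis by simp
  qed
  have init: "\<delta> / e * K_abs (c i) \<le> C_abs (\<Sum>i<Suc n. \<iota> (c i) * w i)" if "i < n" for c i
  proof -
    let ?s = "\<Sum>i<Suc n. \<iota> (c i) * w i"
    have "\<delta> * K_abs (c i) \<le> C_abs (?s - \<iota> (c n) * w n)"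
      using IH[OF that, of c] by simp
    also have "\<dots> \<le> max (C_abs ?s) (K_abs (c n) * C_abs (w n))"
      using abs_diff_le[of ?s "\<iota> (c n) * w n"] by (simp only: abs_mult abs_\<iota>)
    also have "\<dots> \<le> C_abs ?s * e"
    proof (rule max.boundedI)
      show "C_abs ?s \<le> C_abs ?s * e"
        using mult_left_mono[OF e, of "C_abs ?s"] by simp
      have "K_abs (c n) \<le> C_abs ?s / d"
        using last[of c] d by (simp add: field_simps)
      then have "K_abs (c n) * C_abs (w n) \<le> C_abs ?s / d * C_abs (w n)"
        by (intro mult_right_mono) auto
      also have "\<dots> \<le> C_abs ?s * e"
        by (simp add: e_def algebra_simps)
      finally show "K_abs (c n) * C_abs (w n) \<le> C_abs ?s * e" .
    qed
    finally show ?thesis using e by (simp add: field_simps)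
  qed
  have "min d (\<delta> / e) * K_abs (c i) \<le> C_abs (\<Sum>i<Suc n. \<iota> (c i) * w i)" if "i < Suc n" for c i
  proof (cases "i = n")
    case True
    have "min d (\<delta> / e) * K_abs (c i) \<le> d * K_abs (c i)"
      by (intro mult_right_mono K_abs_nonneg) simp
    with last[of c] True show ?thesis by simp
  next
    case False
    have "min d (\<delta> / e) * K_abs (c i) \<le> \<delta> / e * K_abs (c i)"
      by (intro mult_right_mono K_abs_nonneg) simp
    with init[of i c] False that show ?thesis by simp
  qed
  moreover have "min d (\<delta> / e) > 0" using d \<delta> e by simp
  ultimately show ?case by blast
qed

end

subsection \<open>Exponentials of discrete subspaces\<close>

definition part_exp :: "'a::field set \<Rightarrow> 'a \<Rightarrow> 'a" where
  "part_exp V z = z * (\<Prod>v\<in>V-{0}. 1 - z / v)"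

lemma part_exp_eq_0_iff:
  assumes "finite V" "0 \<in> V"
  shows "part_exp V z = 0 \<longleftrightarrow> z \<in> V"
  using assms by (auto simp: part_exp_def)

text \<open>Passes between the monic product, for which roots can be counted, and the normalization
  of the exponential. The constant is nonzero and cancels from identities.\<close>

lemma prod_diff_eq_part_exp:
  fixes V :: "'a::field set"
  assumes "finite V" "0 \<in> V"
  shows "(\<Prod>v\<in>V. z - v) = (\<Prod>v\<in>V-{0}. - v) * part_exp V z"
proof -
  have "(\<Prod>v\<in>V. z - v) = z * (\<Prod>v\<in>V-{0}. z - v)"
    using assms by (subst prod.remove[of V 0]) auto
  also have "(\<Prod>v\<in>V-{0}. z - v) = (\<Prod>v\<in>V-{0}. (- v) * (1 - z / v))"
    by (intro prod.cong) (auto simp: field_simps)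
  finally show ?thesis
    by (simp only: part_exp_def prod.distrib mult_ac)
qed

lemma prod_uminus_nonzero: "finite V \<Longrightarrow> (\<Prod>v\<in>V-{0::'a::field}. - v) \<noteq> 0"
  by auto

text \<open>
  In \<open>x\<close>, both sides of the additivity relation for \<open>\<Prod>v\<in>V. x - v\<close> are monic of degree \<open>card V\<close>,
  and they agree on \<open>V\<close>.
\<close>

lemma part_exp_add:
  fixes V :: "'a::field set"
  assumes fin: "finite V" and zero: "0 \<in> V"
    and diff: "\<And>a b. a \<in> V \<Longrightarrow> b \<in> V \<Longrightarrow> a - b \<in> V"
  shows "part_exp V (x + y) = part_exp V x + part_exp V y"
proof -
  define p where "p = (\<Prod>v\<in>V. [:- v, 1:])"
  define g where "g = (\<Prod>v\<in>V. [:y - v, 1:])"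
  have add: "a + b \<in> V" if "a \<in> V" "b \<in> V" for a b
    using diff[OF that(1) diff[OF zero that(2)]] by simp
  have card_pos: "card V > 0" using fin zero by (auto simp: card_gt_0_iff)
  have deg: "degree p = card V" "degree g = card V"
    unfolding p_def g_def by (subst degree_prod_sum_eq; simp)+
  have lead: "lead_coeff p = 1" "lead_coeff g = 1"
    unfolding p_def g_def by (simp_all add: lead_coeff_prod)
  have "g = p + [:poly p y:]"
  proof (rule poly_eqI_degree_lead_coeff[where n = "card V" and A = V])
    show "coeff g (card V) = coeff (p + [:poly p y:]) (card V)"
      using lead deg card_pos by (simp add: coeff_pCons split: nat.split)
    show "degree (p + [:poly p y:]) \<le> card V"
      using deg by (intro degree_add_le) auto
    fix x assume x: "x \<in> V"
    have "poly g x = (\<Prod>v\<in>V. x + (y - v))"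
      by (simp add: g_def poly_prod add.commute)
    also have "\<dots> = (\<Prod>v\<in>V. y - v)"
      by (rule prod.reindex_bij_witness[of _ "\<lambda>v. v + x" "\<lambda>v. v - x"]) (auto intro: add diff x)
    also have "\<dots> = poly p y" by (simp add: p_def poly_prod)
    also have "\<dots> = poly (p + [:poly p y:]) x"
      using x fin by (auto simp: p_def poly_prod)
    finally show "poly g x = poly (p + [:poly p y:]) x" .
  qed (use deg in auto)
  from arg_cong[OF this, of "\<lambda>p. poly p x"]
  have "(\<Prod>v\<in>V. (x + y) - v) = (\<Prod>v\<in>V. x - v) + (\<Prod>v\<in>V. y - v)"
    by (simp add: g_def p_def poly_prod algebra_simps)
  then have "(\<Prod>v\<in>V-{0}. - v) * part_exp V (x + y) =
      (\<Prod>v\<in>V-{0}. - v) * (part_exp V x + part_exp V y)"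
    by (simp only: prod_diff_eq_part_exp[OF fin zero] distrib_left)
  then show ?thesis using prod_uminus_nonzero[OF fin] by (metis mult_left_cancel)
qed

lemma part_exp_scale:
  fixes V :: "'a::field set"
  assumes "c \<noteq> 0" and "\<And>v. v \<in> V \<Longrightarrow> c * v \<in> V" and "\<And>v. v \<in> V \<Longrightarrow> inverse c * v \<in> V"
  shows "part_exp V (c * z) = c * part_exp V z"
proof -
  have "(\<Prod>v\<in>V-{0}. 1 - c * z / v) = (\<Prod>v\<in>V-{0}. 1 - z / v)"
    by (rule prod.reindex_bij_witness[of _ "\<lambda>v. c * v" "\<lambda>v. inverse c * v"])
      (use assms in \<open>auto simp: field_simps\<close>)
  then show ?thesis by (simp add: part_exp_def)
qed

text \<open>Numerators and denominators over a coset are values of one product, at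
  \<open>\<mu> - z\<close> and at \<open>\<mu>\<close>, and additivity splits the former. A whole
  coset thus contributes a single linear factor in \<open>part_exp V z\<close>.\<close>

lemma prod_translate_part_exp:
  fixes V :: "'a::field set"
  assumes fin: "finite V" and zero: "0 \<in> V"
    and diff: "\<And>a b. a \<in> V \<Longrightarrow> b \<in> V \<Longrightarrow> a - b \<in> V"
    and \<mu>: "\<mu> \<notin> V"
  shows "(\<Prod>v\<in>V. 1 - z / (\<mu> + v)) = 1 - part_exp V z / part_exp V \<mu>"
proof -
  have neg: "- a \<in> V" if "a \<in> V" for a using diff[OF zero that] by simp
  define k where "k = (\<Prod>v\<in>V-{0}. - v)"
  have k: "k \<noteq> 0" unfolding k_def by (rule prod_uminus_nonzero[OF fin])
  have prod: "(\<Prod>v\<in>V. x + v) = k * part_exp V x" for x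
  proof -
    have "(\<Prod>v\<in>V. x + v) = (\<Prod>v\<in>V. x - v)"
      by (rule prod.reindex_bij_witness[of _ uminus uminus]) (auto intro: neg)
    then show ?thesis by (simp add: prod_diff_eq_part_exp[OF fin zero] k_def)
  qed
  have nz: "\<mu> + v \<noteq> 0" if "v \<in> V" for v
    using \<mu> neg[OF that] by (metis add_eq_0_iff2)
  have "(\<Prod>v\<in>V. 1 - z / (\<mu> + v)) = (\<Prod>v\<in>V. ((\<mu> - z) + v) / (\<mu> + v))"
    by (intro prod.cong) (use nz in \<open>auto simp: field_simps\<close>)
  also have "\<dots> = part_exp V (\<mu> - z) / part_exp V \<mu>"
    using k by (simp add: prod_dividef prod)
  also have "part_exp V (\<mu> - z) = part_exp V \<mu> - part_exp V z"
    using part_exp_add[OF fin zero diff, of "\<mu> - z" z] by simp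
  finally show ?thesis
    using \<mu> by (simp add: diff_divide_distrib part_exp_eq_0_iff[OF fin zero])
qed

text \<open>
  With \<open>B\<close> a transversal of \<open>T * V\<close> in \<open>V'\<close>, this is the functional equation of the exponential
  at finite level, with denominators cleared.
\<close>

lemma part_exp_functional_equation:
  fixes V :: "'a::field set"
  assumes fin: "finite V" and zero: "0 \<in> V"
    and diff: "\<And>a b. a \<in> V \<Longrightarrow> b \<in> V \<Longrightarrow> a - b \<in> V"
    and T: "T \<noteq> 0" and B: "finite B" "0 \<in> B"
    and inj: "inj_on (\<lambda>(r, v). r + T * v) (B \<times> V)"
    and V': "V' = (\<lambda>(r, v). r + T * v) ` (B \<times> V)"
  shows "part_exp V' (T * z) * (\<Prod>r\<in>B-{0}. part_exp V (r / T)) =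
    T * part_exp V z * (\<Prod>r\<in>B-{0}. part_exp V (r / T) - part_exp V z)"
proof -
  \<comment> \<open>Otherwise \<open>r\<close> would have two representations, 0 + T (r/T) and r + T
    0.\<close>
  have notin: "r / T \<notin> V" if "r \<in> B - {0}" for r
  proof
    assume v: "r / T \<in> V"
    have "(0, r / T) = (r, 0)"
      by (rule inj_onD[OF inj]) (use that v zero B T in auto)
    with that show False by simp
  qed
  have "V' - {0} = (\<lambda>(r, v). r + T * v) ` (B \<times> V - {(0, 0)})"
    unfolding V' using inj_on_image_set_diff[OF inj, of "B \<times> V" "{(0, 0)}"] B zero by auto
  \<comment> \<open>The coset of 0 is treated separately: it lacks the factor of the lattice point 0
    and yields \<open>part_exp V z\<close> itself.\<close>
  also have "B \<times> V - {(0, 0)} = {0} \<times> (V - {0}) \<union> (B - {0}) \<times> V"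
    using B zero by auto
  finally have V'_eq: "V' - {0} = (\<lambda>(r, v). r + T * v) ` ({0} \<times> (V - {0}) \<union> (B - {0}) \<times> V)" .
  have inj': "inj_on (\<lambda>(r, v). r + T * v) ({0} \<times> (V - {0}) \<union> (B - {0}) \<times> V)"
    by (rule inj_on_subset[OF inj]) (use B zero in auto)
  have "(\<Prod>v\<in>V'-{0}. 1 - T * z / v) =
      (\<Prod>(r, v)\<in>{0} \<times> (V - {0}) \<union> (B - {0}) \<times> V. 1 - T * z / (r + T * v))"
    unfolding V'_eq by (subst prod.reindex[OF inj']) (simp add: case_prod_unfold)
  also have "\<dots> = (\<Prod>(r, v)\<in>{0} \<times> (V - {0}). 1 - T * z / (r + T * v)) *
      (\<Prod>(r, v)\<in>(B - {0}) \<times> V. 1 - T * z / (r + T * v))"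
    by (rule prod.union_disjoint) (use fin B in auto)
  also have "(\<Prod>(r, v)\<in>{0} \<times> (V - {0}). 1 - T * z / (r + T * v)) = (\<Prod>v\<in>V-{0}. 1 - z / v)"
    by (subst prod.cartesian_product[symmetric]) (use T in simp)
  also have "(\<Prod>(r, v)\<in>(B - {0}) \<times> V. 1 - T * z / (r + T * v)) =
      (\<Prod>r\<in>B-{0}. \<Prod>v\<in>V. 1 - T * z / (r + T * v))"
    by (rule prod.cartesian_product[symmetric])
  also have "\<dots> = (\<Prod>r\<in>B-{0}. 1 - part_exp V z / part_exp V (r / T))"
  proof (rule prod.cong[OF refl])
    fix r assume r: "r \<in> B - {0}"
    have "T * z / (r + T * v) = z / (r / T + v)" for v
    proof -
      have "r + T * v = T * (r / T + v)" using T by (simp add: field_simps)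
      then show ?thesis using T by simp
    qed
    then show "(\<Prod>v\<in>V. 1 - T * z / (r + T * v)) = 1 - part_exp V z / part_exp V (r / T)"
      using prod_translate_part_exp[OF fin zero diff notin[OF r]] by simp
  qed
  finally have "part_exp V' (T * z) =
      T * part_exp V z * (\<Prod>r\<in>B-{0}. 1 - part_exp V z / part_exp V (r / T))"
    by (simp add: part_exp_def mult_ac)
  also have "\<dots> * (\<Prod>r\<in>B-{0}. part_exp V (r / T)) = T * part_exp V z *
      (\<Prod>r\<in>B-{0}. (1 - part_exp V z / part_exp V (r / T)) * part_exp V (r / T))"
    by (simp add: prod.distrib mult.assoc)
  also have "(\<Prod>r\<in>B-{0}. (1 - part_exp V z / part_exp V (r / T)) * part_exp V (r / T)) =
      (\<Prod>r\<in>B-{0}. part_exp V (r / T) - part_exp V z)"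
    by (intro prod.cong)
      (use notin in \<open>auto simp: left_diff_distrib part_exp_eq_0_iff[OF fin zero]\<close>)
  finally show ?thesis .
qed

section \<open>Absolute values of elements of A and of products close to 1\<close>

context completed_algebraic_closure
begin

lemma abs_fls_const: "c \<noteq> 0 \<Longrightarrow> C_abs (\<iota> (fls_const c)) = 1"
  by (simp add: abs_\<iota> K_abs_def)

lemma abs_T: "C_abs (\<iota> fls_X_inv) = real CARD('f)"
  by (simp add: abs_\<iota> K_abs_def)

lemma T_nonzero: "\<iota> fls_X_inv \<noteq> 0"
  by simp

sublocale F: scalar_hom "\<lambda>c. \<iota> (fls_const c)" "CARD('f)"
  by unfold_locales
    (simp_all add: \<iota>_one \<iota>_add[symmetric] \<iota>_mult[symmetric] fls_plus_const)

lemma A_emb_0 [simp]: "A_emb \<iota> 0 = 0"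
  by (simp add: A_emb_def)

lemma A_emb_pCons: "A_emb \<iota> (pCons c a) = \<iota> (fls_const c) + \<iota> fls_X_inv * A_emb \<iota> a"
  by (simp add: A_emb_def map_poly_pCons \<iota>_add \<iota>_mult)

lemma A_emb_add: "A_emb \<iota> (a + b) = A_emb \<iota> a + A_emb \<iota> b"
  by (induction a b rule: poly_induct2) (simp_all add: A_emb_pCons F.hom_add algebra_simps)

lemma A_emb_smult: "A_emb \<iota> (Polynomial.smult c a) = \<iota> (fls_const c) * A_emb \<iota> a"
  by (induction a) (simp_all add: A_emb_pCons F.hom_mult algebra_simps del: fls_const_mult_const)

lemma A_emb_diff: "A_emb \<iota> (a - b) = A_emb \<iota> a - A_emb \<iota> b"
  using A_emb_add[of "a - b" b] by simp

lemma abs_A_emb: "a \<noteq> 0 \<Longrightarrow> C_abs (A_emb \<iota> a) = real CARD('f) ^ degree a"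
proof (induction a)
  case (pCons c a)
  show ?case
  proof (cases "a = 0")
    case True
    with pCons show ?thesis by (simp add: A_emb_pCons abs_fls_const)
  next
    case False
    with pCons have *: "C_abs (\<iota> fls_X_inv * A_emb \<iota> a) = real CARD('f) ^ Suc (degree a)"
      by (simp add: abs_mult abs_T)
    have "1 < real CARD('f)" using two_le_card_field[where 'f='f] by linarith
    then have "1 < real CARD('f) ^ Suc (degree a)" by (intro one_less_power) auto
    moreover have "C_abs (\<iota> (fls_const c)) \<le> 1"
      by (cases "c = 0") (simp_all add: abs_fls_const)
    ultimately have "C_abs (\<iota> (fls_const c)) < C_abs (\<iota> fls_X_inv * A_emb \<iota> a)"
      unfolding * by linarith
    from abs_add_eq[OF this] show ?thesis
      using False by (simp add: A_emb_pCons * del: power_Suc)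
  qed
qed simp

lemma A_emb_eq_0_iff [simp]: "A_emb \<iota> a = 0 \<longleftrightarrow> a = 0"
  by (metis A_emb_0 abs_0 abs_A_emb power_eq_0_iff of_nat_eq_0_iff zero_less_card_finite less_numeral_extra(3))

text \<open>By the ultrametric inequality the bound does not depend on the number of factors, which
  is what makes the net over all finite subsets converge.\<close>

lemma abs_prod_one_minus_le:
  assumes "finite F" "\<And>l. l \<in> F \<Longrightarrow> R < C_abs l" "C_abs z \<le> R" "0 < R"
  shows "C_abs ((\<Prod>l\<in>F. 1 - z / l) - 1 :: 'c) \<le> C_abs z / R"
  using assms
proof (induction F rule: finite_induct)
  case (insert l F)
  have l: "R < C_abs l" "C_abs z < C_abs l" using insert.prems by force+
  let ?p = "\<Prod>l\<in>F. 1 - z / l"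
  have "(\<Prod>l\<in>insert l F. 1 - z / l) - 1 = (1 - z / l) * (?p - 1) + - (z / l)"
    using insert.hyps by (simp add: algebra_simps)
  also have "C_abs \<dots> \<le> max (C_abs (?p - 1)) (C_abs (z / l))"
    using abs_ultrametric[of "(1 - z / l) * (?p - 1)" "- (z / l)"]
    by (simp add: abs_mult abs_one_minus_divide[OF l(2)])
  also have "\<dots> \<le> C_abs z / R"
  proof (rule max.boundedI)
    show "C_abs (?p - 1) \<le> C_abs z / R" using insert by simp
    show "C_abs (z / l) \<le> C_abs z / R"
      unfolding abs_divide using l(1) \<open>0 < R\<close> abs_nonneg[of z]
      by (intro divide_left_mono mult_pos_pos) linarith+
  qed
  finally show ?case .
qed simp

end

section \<open>Convergence, zeros and linearity of the exponential\<close>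

locale discrete_subspace = completed_algebraic_closure \<iota>
  for \<iota> :: "'f::{finite,field} fls \<Rightarrow> 'c::{alg_closed_field,complete_space}" +
  fixes \<Lambda> :: "'c set"
  assumes zero_mem: "0 \<in> \<Lambda>"
    and diff_mem: "a \<in> \<Lambda> \<Longrightarrow> b \<in> \<Lambda> \<Longrightarrow> a - b \<in> \<Lambda>"
    and scale_mem: "a \<in> \<Lambda> \<Longrightarrow> \<iota> (fls_const c) * a \<in> \<Lambda>"
    and finite_ball: "finite {l \<in> \<Lambda>. C_abs l \<le> R}"
begin

abbreviation ex :: "'c \<Rightarrow> 'c" where "ex \<equiv> lattice_exp \<Lambda>"

definition \<Lambda>_ball :: "real \<Rightarrow> 'c set" where "\<Lambda>_ball R = {l \<in> \<Lambda> - {0}. C_abs l \<le> R}"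

lemma finite_\<Lambda>_ball: "finite (\<Lambda>_ball R)"
  by (rule finite_subset[OF _ finite_ball[of R]]) (auto simp: \<Lambda>_ball_def)

text \<open>Factors with |l| > |z| have absolute value 1, so the absolute values of the partial
  products are eventually constant.\<close>

lemma abs_partial_product:
  assumes "finite F" "\<Lambda>_ball (C_abs z) \<subseteq> F" "F \<subseteq> \<Lambda> - {0}"
  shows "C_abs (z * (\<Prod>l\<in>F. 1 - z / l)) = C_abs (z * (\<Prod>l\<in>\<Lambda>_ball (C_abs z). 1 - z / l))"
proof -
  have "(\<Prod>l\<in>F. 1 - z / l) =
      (\<Prod>l\<in>F - \<Lambda>_ball (C_abs z). 1 - z / l) * (\<Prod>l\<in>\<Lambda>_ball (C_abs z). 1 - z / l)"
    by (rule prod.subset_diff) (use assms in auto)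
  moreover have "C_abs (\<Prod>l\<in>F - \<Lambda>_ball (C_abs z). 1 - z / l) = 1"
    unfolding abs_prod
    by (rule prod.neutral) (use assms in \<open>auto simp: \<Lambda>_ball_def intro!: abs_one_minus_divide\<close>)
  ultimately show ?thesis by (simp add: abs_mult)
qed

lemma partial_product_close:
  assumes "finite F" "\<Lambda>_ball R \<subseteq> F" "F \<subseteq> \<Lambda> - {0}" "C_abs z \<le> R" "0 < R"
  shows "C_abs (z * (\<Prod>l\<in>F. 1 - z / l) - z * (\<Prod>l\<in>\<Lambda>_ball R. 1 - z / l)) \<le>
    C_abs (z * (\<Prod>l\<in>\<Lambda>_ball (C_abs z). 1 - z / l)) * C_abs z / R"
proof -
  have "(\<Prod>l\<in>F. 1 - z / l) = (\<Prod>l\<in>F - \<Lambda>_ball R. 1 - z / l) * (\<Prod>l\<in>\<Lambda>_ball R. 1 - z / l)"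
    by (rule prod.subset_diff) (use assms in auto)
  then have "z * (\<Prod>l\<in>F. 1 - z / l) - z * (\<Prod>l\<in>\<Lambda>_ball R. 1 - z / l) =
      z * (\<Prod>l\<in>\<Lambda>_ball R. 1 - z / l) * ((\<Prod>l\<in>F - \<Lambda>_ball R. 1 - z / l) - 1)"
    by (simp add: algebra_simps)
  moreover have "C_abs (z * (\<Prod>l\<in>\<Lambda>_ball R. 1 - z / l)) =
      C_abs (z * (\<Prod>l\<in>\<Lambda>_ball (C_abs z). 1 - z / l))"
    by (rule abs_partial_product[OF finite_\<Lambda>_ball]) (use assms in \<open>auto simp: \<Lambda>_ball_def\<close>)
  moreover have "C_abs ((\<Prod>l\<in>F - \<Lambda>_ball R. 1 - z / l) - 1) \<le> C_abs z / R"
    by (rule abs_prod_one_minus_le) (use assms in \<open>auto simp: \<Lambda>_ball_def\<close>)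
  ultimately show ?thesis
    using mult_left_mono[of "C_abs ((\<Prod>l\<in>F - \<Lambda>_ball R. 1 - z / l) - 1)" "C_abs z / R"
      "C_abs (z * (\<Prod>l\<in>\<Lambda>_ball (C_abs z). 1 - z / l))"]
    by (simp only: abs_mult[of "z * (\<Prod>l\<in>\<Lambda>_ball R. 1 - z / l)"] times_divide_eq_right abs_nonneg)
qed

text \<open>Gives meaning to the \<open>Lim\<close> in \<open>lattice_exp\<close>. The products over
  balls form a Cauchy sequence, and the product over any finite set containing a large ball is close
  to the product over that ball.\<close>

lemma exp_tendsto:
  "((\<lambda>F. z * (\<Prod>l\<in>F. 1 - z / l)) \<longlongrightarrow> ex z) (finite_subsets_at_top (\<Lambda> - {0}))"
proof -
  define P where "P F = z * (\<Prod>l\<in>F. 1 - z / l)" for F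
  define K where "K = C_abs (P (\<Lambda>_ball (C_abs z))) * C_abs z"
  have K: "0 \<le> K" by (simp add: K_def)
  have close: "C_abs (P F - P (\<Lambda>_ball R)) \<le> K / R"
    if "finite F" "\<Lambda>_ball R \<subseteq> F" "F \<subseteq> \<Lambda> - {0}" "C_abs z \<le> R" "0 < R" for F R
    using partial_product_close[OF that] by (simp add: P_def K_def)
  have large: "\<exists>N. C_abs z \<le> real N \<and> 0 < real N \<and> K / real N < \<epsilon>" if "0 < \<epsilon>" for \<epsilon>
  proof -
    obtain N :: nat where "max (max (C_abs z) 1) (K / \<epsilon>) < real N"
      using reals_Archimedean2 by blast
    with that show ?thesis by (auto simp: field_simps intro!: exI[of _ N])
  qed
  have "Cauchy (\<lambda>n. P (\<Lambda>_ball (real n)))"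
  proof (rule metric_CauchyI)
    fix \<epsilon> :: real assume "0 < \<epsilon>"
    from large[OF this] obtain N where N: "C_abs z \<le> real N" "0 < real N" "K / real N < \<epsilon>"
      by blast
    have "C_abs (P (\<Lambda>_ball (real n)) - P (\<Lambda>_ball (real N))) < \<epsilon>" if "n \<ge> N" for n
    proof -
      have "\<Lambda>_ball (real N) \<subseteq> \<Lambda>_ball (real n)" "\<Lambda>_ball (real n) \<subseteq> \<Lambda> - {0}"
        using that by (auto simp: \<Lambda>_ball_def)
      from close[OF finite_\<Lambda>_ball this N(1,2)] N(3) show ?thesis by simp
    qed
    then have "dist (P (\<Lambda>_ball (real m))) (P (\<Lambda>_ball (real n))) < \<epsilon>" if "m \<ge> N" "n \<ge> N" for m n
      using abs_diff_le[of "P (\<Lambda>_ball (real m)) - P (\<Lambda>_ball (real N))"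
          "P (\<Lambda>_ball (real n)) - P (\<Lambda>_ball (real N))"] that
      unfolding dist_eq_abs by (simp, meson le_less_trans max_less_iff_conj)
    then show "\<exists>M. \<forall>m\<ge>M. \<forall>n\<ge>M. dist (P (\<Lambda>_ball (real m))) (P (\<Lambda>_ball (real n))) < \<epsilon>"
      by blast
  qed
  then obtain L where L: "(\<lambda>n. P (\<Lambda>_ball (real n))) \<longlonglongrightarrow> L"
    using Cauchy_convergent convergent_def by blast
  have lim: "(P \<longlongrightarrow> L) (finite_subsets_at_top (\<Lambda> - {0}))"
    unfolding tendsto_iff_abs
  proof (intro allI impI)
    fix \<epsilon> :: real assume \<epsilon>: "0 < \<epsilon>"
    from large[OF this] obtain N where N: "C_abs z \<le> real N" "0 < real N" "K / real N < \<epsilon>"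
      by blast
    have "\<forall>\<^sub>F n in sequentially. C_abs (P (\<Lambda>_ball (real n)) - L) < \<epsilon> \<and> N \<le> n"
      using L \<epsilon> by (intro eventually_conj eventually_ge_at_top) (auto simp: tendsto_iff_abs)
    then obtain n where n: "C_abs (P (\<Lambda>_ball (real n)) - L) < \<epsilon>" "N \<le> n"
      using eventually_happens'[OF sequentially_bot] by blast
    have R: "C_abs z \<le> real n" "0 < real n" using N n by auto
    have "K / real n \<le> K / real N"
      using N n K by (intro divide_left_mono) auto
    with N have Kn: "K / real n < \<epsilon>" by simp
    show "\<forall>\<^sub>F F in finite_subsets_at_top (\<Lambda> - {0}). C_abs (P F - L) < \<epsilon>"
      unfolding eventually_finite_subsets_at_top
    proof (intro exI[of _ "\<Lambda>_ball (real n)"] conjI allI impI)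
      fix F assume F: "finite F \<and> \<Lambda>_ball (real n) \<subseteq> F \<and> F \<subseteq> \<Lambda> - {0}"
      have "C_abs (P F - P (\<Lambda>_ball (real n))) < \<epsilon>"
        using close[of F "real n"] F R Kn by auto
      with n abs_ultrametric[of "P F - P (\<Lambda>_ball (real n))" "P (\<Lambda>_ball (real n)) - L"]
      show "C_abs (P F - L) < \<epsilon>" by simp
    qed (auto simp: finite_\<Lambda>_ball, auto simp: \<Lambda>_ball_def)
  qed
  moreover from this have "ex z = L"
    unfolding lattice_exp_def P_def by (intro tendsto_Lim) auto
  ultimately show ?thesis by (simp add: P_def[abs_def])
qed

lemma abs_exp: "C_abs (ex z) = C_abs (z * (\<Prod>l\<in>\<Lambda>_ball (C_abs z). 1 - z / l))"
proof (rule tendsto_unique)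
  show "((\<lambda>F. C_abs (z * (\<Prod>l\<in>F. 1 - z / l))) \<longlongrightarrow> C_abs (ex z)) (finite_subsets_at_top (\<Lambda> - {0}))"
    by (rule C_tendsto_abs[OF exp_tendsto])
  have "\<forall>\<^sub>F F in finite_subsets_at_top (\<Lambda> - {0}).
      C_abs (z * (\<Prod>l\<in>F. 1 - z / l)) = C_abs (z * (\<Prod>l\<in>\<Lambda>_ball (C_abs z). 1 - z / l))"
    unfolding eventually_finite_subsets_at_top
    by (intro exI[of _ "\<Lambda>_ball (C_abs z)"])
      (auto simp: finite_\<Lambda>_ball intro: abs_partial_product, auto simp: \<Lambda>_ball_def)
  then show "((\<lambda>F. C_abs (z * (\<Prod>l\<in>F. 1 - z / l))) \<longlongrightarrow>
      C_abs (z * (\<Prod>l\<in>\<Lambda>_ball (C_abs z). 1 - z / l))) (finite_subsets_at_top (\<Lambda> - {0}))"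
    by (rule tendsto_eventually)
qed simp

text \<open>A limit of nonzero values might vanish, but here its absolute value is that of one
  finite product, whose zeros are visible.\<close>

lemma exp_eq_0_iff: "ex z = 0 \<longleftrightarrow> z \<in> \<Lambda>"
proof -
  have "ex z = 0 \<longleftrightarrow> z * (\<Prod>l\<in>\<Lambda>_ball (C_abs z). 1 - z / l) = 0"
    using abs_exp[of z] by (metis abs_eq_0_iff)
  also have "\<dots> \<longleftrightarrow> z \<in> \<Lambda>"
    using zero_mem by (auto simp: finite_\<Lambda>_ball) (auto simp: \<Lambda>_ball_def)
  finally show ?thesis .
qed

text \<open>Stated for arbitrary exhaustions because two occur: balls, and the sets B + T V with V a
  ball in the functional equation.\<close>

lemma part_exp_tendsto:
  fixes V :: "nat \<Rightarrow> 'c set"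
  assumes "\<And>n. finite (V n)" "\<And>n. V n \<subseteq> \<Lambda>" "\<And>l. l \<in> \<Lambda> \<Longrightarrow> \<forall>\<^sub>F n in sequentially. l \<in> V n"
  shows "(\<lambda>n. part_exp (V n) z) \<longlonglongrightarrow> ex z"
proof -
  have "filterlim (\<lambda>n. V n - {0}) (finite_subsets_at_top (\<Lambda> - {0})) sequentially"
    unfolding filterlim_finite_subsets_at_top
  proof (intro allI impI)
    fix X assume X: "finite X \<and> X \<subseteq> \<Lambda> - {0}"
    then have "\<forall>\<^sub>F n in sequentially. \<forall>l\<in>X. l \<in> V n"
      using assms(3) by (intro eventually_ball_finite) auto
    then show "\<forall>\<^sub>F n in sequentially. finite (V n - {0}) \<and> X \<subseteq> V n - {0} \<and> V n - {0} \<subseteq> \<Lambda> - {0}"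
      by eventually_elim (use X assms in auto)
  qed
  from filterlim_compose[OF exp_tendsto this] show ?thesis
    by (simp add: part_exp_def)
qed

text \<open>Balls are finite \<open>F_q\<close>-subspaces by the ultrametric inequality. Unlike
  \<open>\<Lambda>_ball\<close>, these contain 0, as the identities for \<open>part_exp\<close>
  require.\<close>

definition V_ball :: "nat \<Rightarrow> 'c set" where "V_ball n = {l \<in> \<Lambda>. C_abs l \<le> real n}"

lemma V_ball_subset: "V_ball n \<subseteq> \<Lambda>"
  and finite_V_ball: "finite (V_ball n)"
  and zero_V_ball: "0 \<in> V_ball n"
  by (auto simp: V_ball_def finite_ball zero_mem)

lemma diff_V_ball: "a \<in> V_ball n \<Longrightarrow> b \<in> V_ball n \<Longrightarrow> a - b \<in> V_ball n"
  using abs_diff_le[of a b] by (auto simp: V_ball_def diff_mem)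

lemma scale_V_ball: "a \<in> V_ball n \<Longrightarrow> \<iota> (fls_const c) * a \<in> V_ball n"
  by (cases "c = 0") (auto simp: V_ball_def scale_mem abs_mult abs_fls_const zero_mem)

lemma eventually_V_ball: "l \<in> \<Lambda> \<Longrightarrow> \<forall>\<^sub>F n in sequentially. l \<in> V_ball n"
  using eventually_ge_at_top[of "nat \<lceil>C_abs l\<rceil>"]
  by (auto simp: V_ball_def elim!: eventually_mono)

lemma V_ball_tendsto: "(\<lambda>n. part_exp (V_ball n) z) \<longlonglongrightarrow> ex z"
  by (intro part_exp_tendsto finite_V_ball V_ball_subset eventually_V_ball)

lemma exp_add: "ex (x + y) = ex x + ex y"
proof (rule tendsto_unique[OF sequentially_bot V_ball_tendsto])
  have "part_exp (V_ball n) (x + y) = part_exp (V_ball n) x + part_exp (V_ball n) y" for n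
    by (rule part_exp_add[OF finite_V_ball zero_V_ball diff_V_ball])
  then show "(\<lambda>n. part_exp (V_ball n) (x + y)) \<longlonglongrightarrow> ex x + ex y"
    by (simp add: C_tendsto_add V_ball_tendsto)
qed

lemma exp_0 [simp]: "ex 0 = 0"
  by (simp add: exp_eq_0_iff zero_mem)

lemma exp_diff: "ex (x - y) = ex x - ex y"
  using exp_add[of "x - y" y] by simp

lemma exp_scale: "ex (\<iota> (fls_const c) * z) = \<iota> (fls_const c) * ex z"
proof (cases "c = 0")
  case False
  then have inv: "inverse (\<iota> (fls_const c)) = \<iota> (fls_const (inverse c))"
    by (intro inverse_unique) (simp flip: F.hom_mult \<iota>_mult add: \<iota>_one)
  have *: "part_exp (V_ball n) (\<iota> (fls_const c) * z) = \<iota> (fls_const c) * part_exp (V_ball n) z" for n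
    by (rule part_exp_scale) (use False inv scale_V_ball in auto)
  show ?thesis
  proof (rule tendsto_unique[OF sequentially_bot V_ball_tendsto])
    show "(\<lambda>n. part_exp (V_ball n) (\<iota> (fls_const c) * z)) \<longlonglongrightarrow> \<iota> (fls_const c) * ex z"
      unfolding * by (intro C_tendsto_mult V_ball_tendsto tendsto_const)
  qed
qed simp

lemma exp_sum: "ex (\<Sum>i\<in>I. f i) = (\<Sum>i\<in>I. ex (f i))"
  by (induction I rule: infinite_finite_induct) (simp_all add: exp_add)

text \<open>Makes a polynomial determined by its values on the image of the exponential. Near 0 the
  exponential preserves absolute values, so the powers of 1/T have infinitely many images.\<close>

lemma infinite_range_exp: "infinite (range ex)"
proof
  assume fin: "finite (range ex)"
  \<comment> \<open>The inserted 1 covers an empty ball and ensures that lattice points of absolute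
    value below \<delta> lie in \<open>\<Lambda>_ball 1\<close>.\<close>
  define \<delta> where "\<delta> = Min (insert 1 (C_abs ` \<Lambda>_ball 1))"
  have \<delta>: "0 < \<delta>" "\<delta> \<le> 1" and \<delta>_le: "\<And>l. l \<in> \<Lambda>_ball 1 \<Longrightarrow> \<delta> \<le> C_abs l"
    using finite_\<Lambda>_ball[of 1] by (auto simp: \<delta>_def \<Lambda>_ball_def)
  have small: "C_abs (ex z) = C_abs z" if "C_abs z < \<delta>" for z
  proof -
    have "\<Lambda>_ball (C_abs z) = {}"
    proof (rule ccontr)
      assume "\<Lambda>_ball (C_abs z) \<noteq> {}"
      then obtain l where l: "l \<in> \<Lambda>_ball (C_abs z)" by blast
      then have "l \<in> \<Lambda>_ball 1" "C_abs l \<le> C_abs z" using that \<delta> by (auto simp: \<Lambda>_ball_def)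
      with \<delta>_le[of l] that show False by simp
    qed
    then show ?thesis by (simp add: abs_exp)
  qed
  define q where "q = real CARD('f)"
  have q: "q > 1" using two_le_card_field[where 'f='f] by (simp add: q_def)
  have abs_z: "C_abs (inverse (\<iota> fls_X_inv) ^ n) = inverse q ^ n" for n
    by (simp add: abs_power abs_inverse abs_T q_def)
  have "(\<lambda>n. inverse q ^ n) \<longlonglongrightarrow> 0"
    using q by (intro LIMSEQ_power_zero) (simp add: inverse_less_1_iff)
  then have "\<forall>\<^sub>F n in sequentially. inverse q ^ n < \<delta>"
    using \<delta>(1) by (rule order_tendstoD)
  then obtain N where N: "\<And>n. n \<ge> N \<Longrightarrow> inverse q ^ n < \<delta>"
    by (auto simp: eventually_sequentially)
  have "(\<lambda>n. inverse q ^ n) ` {N..} \<subseteq> C_abs ` range ex"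
  proof
    fix y assume "y \<in> (\<lambda>n. inverse q ^ n) ` {N..}"
    then obtain n where n: "n \<ge> N" "y = inverse q ^ n" by auto
    then have "y = C_abs (ex (inverse (\<iota> fls_X_inv) ^ n))"
      using small[of "inverse (\<iota> fls_X_inv) ^ n"] N abs_z by simp
    then show "y \<in> C_abs ` range ex" by blast
  qed
  moreover have "inj_on (\<lambda>n. inverse q ^ n) {N..}"
    using q by (auto simp: inj_on_def power_inverse)
  ultimately have "finite {N..}"
    using fin by (meson finite_imageI finite_imageD finite_subset)
  then show False by (simp add: infinite_Ici)
qed

text \<open>The limit of the finite identity: the balls and the sets \<open>V' n\<close> both
  exhaust \<Lambda>, so the same exponential appears on both sides. With denominators cleared, no
  limit of a quotient is taken.\<close>

lemma exp_functional_equation: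
  assumes B: "finite B" "0 \<in> B"
    and bij: "bij_betw (\<lambda>(r, l). r + \<iota> fls_X_inv * l) (B \<times> \<Lambda>) \<Lambda>"
  shows "ex (\<iota> fls_X_inv * z) * (\<Prod>r\<in>B-{0}. ex (r / \<iota> fls_X_inv)) =
    \<iota> fls_X_inv * ex z * (\<Prod>r\<in>B-{0}. ex (r / \<iota> fls_X_inv) - ex z)"
proof -
  let ?T = "\<iota> fls_X_inv"
  define V' where "V' n = (\<lambda>(r, l). r + ?T * l) ` (B \<times> V_ball n)" for n
  have sub: "B \<times> V_ball n \<subseteq> B \<times> \<Lambda>" for n using V_ball_subset by auto
  have V'_tendsto: "(\<lambda>n. part_exp (V' n) w) \<longlonglongrightarrow> ex w" for w
  proof (rule part_exp_tendsto)
    show "finite (V' n)" for n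
      unfolding V'_def using B finite_V_ball by blast
    show "V' n \<subseteq> \<Lambda>" for n
      unfolding V'_def using bij_betw_imp_surj_on[OF bij] sub[of n] by blast
    show "\<forall>\<^sub>F n in sequentially. l \<in> V' n" if l: "l \<in> \<Lambda>" for l
    proof -
      obtain r m where rm: "r \<in> B" "m \<in> \<Lambda>" "l = r + ?T * m"
        using bij_betw_imp_surj_on[OF bij] l by force
      from eventually_V_ball[OF rm(2)] show ?thesis
        by eventually_elim (use rm in \<open>auto simp: V'_def\<close>)
    qed
  qed
  have eq: "part_exp (V' n) (?T * z) * (\<Prod>r\<in>B-{0}. part_exp (V_ball n) (r / ?T)) =
      ?T * part_exp (V_ball n) z * (\<Prod>r\<in>B-{0}. part_exp (V_ball n) (r / ?T) - part_exp (V_ball n) z)" for n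
    by (rule part_exp_functional_equation[OF finite_V_ball zero_V_ball diff_V_ball T_nonzero B
          inj_on_subset[OF bij_betw_imp_inj_on[OF bij] sub] V'_def])
  show ?thesis
  proof (rule tendsto_unique[OF sequentially_bot])
    show "(\<lambda>n. part_exp (V' n) (?T * z) * (\<Prod>r\<in>B-{0}. part_exp (V_ball n) (r / ?T))) \<longlonglongrightarrow>
        ex (?T * z) * (\<Prod>r\<in>B-{0}. ex (r / ?T))"
      by (intro C_tendsto_mult C_tendsto_prod V'_tendsto V_ball_tendsto)
    show "(\<lambda>n. part_exp (V' n) (?T * z) * (\<Prod>r\<in>B-{0}. part_exp (V_ball n) (r / ?T))) \<longlonglongrightarrow>
        ?T * ex z * (\<Prod>r\<in>B-{0}. ex (r / ?T) - ex z)"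
      unfolding eq
      by (intro C_tendsto_mult C_tendsto_prod C_tendsto_diff tendsto_const V_ball_tendsto)
  qed
qed

end

subsection \<open>The Drinfeld module of a lattice\<close>

context scalar_hom
begin

text \<open>
  With \<open>V\<close> spanned by \<open>u 0, \<dots>, u (k - 1)\<close> and \<open>f\<^sub>V = \<Prod>v\<in>V. X - v\<close>, the recursion is
  \<open>\<Prod>\<^sub>c f\<^sub>V(X - c u\<^sub>k) = \<Prod>\<^sub>c (f\<^sub>V - c f\<^sub>V(u\<^sub>k))\<close>.
\<close>

primrec span_poly :: "(nat \<Rightarrow> 'c) \<Rightarrow> nat \<Rightarrow> 'c poly" where
  "span_poly u 0 = [:0, 1:]"
| "span_poly u (Suc k) = span_poly u k ^ q -
     Polynomial.smult (poly (span_poly u k) (u k) ^ (q - 1)) (span_poly u k)"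

lemma qpoly_span_poly: "qpoly (span_poly u k)"
proof (induction k)
  case (Suc k)
  with qpoly_power_q_power[of _ 1] show ?case
    by (auto intro!: qpoly_diff qpoly_smult)
qed (simp add: qpoly_linear)

lemma degree_span_poly: "degree (span_poly u k) = q ^ k"
  and monic_span_poly: "lead_coeff (span_poly u k) = 1"
proof (induction k)
  case (Suc k)
  let ?f = "span_poly u k" and ?c = "poly (span_poly u k) (u k) ^ (q - 1)"
  have "?f \<noteq> 0" using Suc by auto
  then have deg: "degree (?f ^ q) = q ^ Suc k"
    using Suc by (simp add: degree_power_eq)
  have "degree (Polynomial.smult ?c ?f) \<le> q ^ k"
    using Suc degree_smult_le[of ?c ?f] by simp
  also have "\<dots> < q ^ Suc k" using q_ge2 by simp
  finally have less: "degree (- Polynomial.smult ?c ?f) < degree (?f ^ q)"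
    by (simp add: deg)
  have "degree (?f ^ q + - Polynomial.smult ?c ?f) = degree (?f ^ q)"
    by (rule degree_add_eq_left[OF less])
  then show d: "degree (span_poly u (Suc k)) = q ^ Suc k"
    by (simp add: deg)
  have "lead_coeff (- Polynomial.smult ?c ?f + ?f ^ q) = lead_coeff (?f ^ q)"
    by (rule lead_coeff_add_le[OF less])
  then show "lead_coeff (span_poly u (Suc k)) = 1"
    using Suc by (simp add: lead_coeff_power)
qed simp_all

lemma poly_span_poly_add: "poly (span_poly u k) (x + y) = poly (span_poly u k) x + poly (span_poly u k) y"
proof (induction k)
  case (Suc k)
  then show ?case by (simp add: power_q_add algebra_simps)
qed simp

lemma poly_span_poly_scale: "poly (span_poly u k) (\<sigma> c * x) = \<sigma> c * poly (span_poly u k) x"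
proof (induction k)
  case (Suc k)
  then show ?case by (simp add: power_mult_distrib hom_power_q algebra_simps)
qed simp

text \<open>By linearity only the last summand survives one level down, with value \<sigma>(c_k) y,
  and this is a root of X^q - y^(q-1) X.\<close>

lemma poly_span_poly_eq_0: "poly (span_poly u k) (\<Sum>i<k. \<sigma> (c i) * u i) = 0"
proof (induction k)
  case (Suc k)
  let ?y = "poly (span_poly u k) (u k)"
  have "poly (span_poly u k) (\<Sum>i<Suc k. \<sigma> (c i) * u i) = \<sigma> (c k) * ?y"
    using Suc by (simp add: poly_span_poly_add poly_span_poly_scale)
  moreover have "?y ^ q = ?y ^ (q - 1) * ?y"
    by (rule power_minus_mult[symmetric]) simp
  ultimately show ?case
    by (simp add: power_mult_distrib hom_power_q del: sum.lessThan_Suc)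
qed simp

end

text \<open>In the application \<open>ws\<close> is the point \<omega>' and \<rho> = r - 1, so that
  the unprimed \<Lambda>, \<phi>, \<Delta> of this locale are the primed objects of the
  theorem.\<close>

locale drinfeld_point = completed_algebraic_closure \<iota>
  for \<iota> :: "'f::{finite,field} fls \<Rightarrow> 'c::{alg_closed_field,complete_space}" +
  fixes ws :: "'c list" and \<rho> q :: nat
  assumes ws: "ws \<in> Omega \<iota> \<rho>" and q_eq: "q = CARD('f)"
begin

abbreviation \<sigma> :: "'f \<Rightarrow> 'c" where "\<sigma> c \<equiv> \<iota> (fls_const c)"
abbreviation T :: 'c where "T \<equiv> \<iota> fls_X_inv"
abbreviation \<Lambda> :: "'c set" where "\<Lambda> \<equiv> lattice \<iota> ws"

sublocale Fq: scalar_hom \<sigma> q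
  using F.scalar_hom_axioms by (simp add: q_eq)

lemma length_ws: "length ws = \<rho>" and \<rho>_pos: "0 < \<rho>"
  and independent: "(\<Sum>i<\<rho>. \<iota> (c i) * ws ! i) = 0 \<Longrightarrow> i < \<rho> \<Longrightarrow> c i = 0"
  using ws by (auto simp: Omega_def)

lemma A_independent:
  assumes "(\<Sum>i<\<rho>. A_emb \<iota> (a i) * ws ! i) = 0" "i < \<rho>"
  shows "a i = 0"
proof -
  from independent[of "\<lambda>i. poly (map_poly fls_const (a i)) fls_X_inv" i] assms
  have "A_emb \<iota> (a i) = 0" by (simp add: A_emb_def)
  then show ?thesis by simp
qed

lemma lattice_iff: "l \<in> \<Lambda> \<longleftrightarrow> (\<exists>a. l = (\<Sum>i<\<rho>. A_emb \<iota> (a i) * ws ! i))"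
  by (auto simp: lattice_def length_ws)

text \<open>The lower bound for linear forms turns a bound on a lattice point into a bound on the
  degrees of its coefficients, and A has finitely many elements of bounded degree.\<close>

lemma finite_lattice_ball: "finite {l \<in> \<Lambda>. C_abs l \<le> R}"
proof -
  obtain \<delta> where \<delta>: "\<delta> > 0"
    and ge: "\<And>c i. i < \<rho> \<Longrightarrow> \<delta> * K_abs (c i) \<le> C_abs (\<Sum>i<\<rho>. \<iota> (c i) * ws ! i)"
    using abs_linear_combination_ge[where n = \<rho> and w = "\<lambda>i. ws ! i"] independent by blast
  obtain n where n: "R / \<delta> < real q ^ n"
    using real_arch_pow[of "real q" "R / \<delta>"] Fq.q_ge2 by auto
  let ?D = "{a :: 'f poly. degree a \<le> n}"
  have "{l \<in> \<Lambda>. C_abs l \<le> R} \<subseteq>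
      (\<lambda>a. \<Sum>i<\<rho>. A_emb \<iota> (a i) * ws ! i) ` (PiE {..<\<rho>} (\<lambda>_. ?D))"
  proof
    fix l assume "l \<in> {l \<in> \<Lambda>. C_abs l \<le> R}"
    then obtain a where a: "l = (\<Sum>i<\<rho>. A_emb \<iota> (a i) * ws ! i)" and R: "C_abs l \<le> R"
      by (auto simp: lattice_iff)
    have "degree (a i) \<le> n" if i: "i < \<rho>" for i
    proof (cases "a i = 0")
      case False
      have "\<delta> * K_abs (poly (map_poly fls_const (a i)) fls_X_inv) \<le> C_abs l"
        unfolding a A_emb_def
        by (rule ge[OF i, of "\<lambda>i. poly (map_poly fls_const (a i)) fls_X_inv"])
      then have "\<delta> * C_abs (A_emb \<iota> (a i)) \<le> R"
        using R by (simp add: A_emb_def abs_\<iota>)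
      then have "real q ^ degree (a i) \<le> R / \<delta>"
        using \<delta> False by (simp add: abs_A_emb q_eq field_simps)
      with n have "real q ^ degree (a i) < real q ^ n" by linarith
      then show ?thesis using Fq.q_ge2 by (simp add: power_strict_increasing_iff)
    qed simp
    then have "restrict a {..<\<rho>} \<in> PiE {..<\<rho>} (\<lambda>_. ?D)" by auto
    moreover have "l = (\<Sum>i<\<rho>. A_emb \<iota> (restrict a {..<\<rho>} i) * ws ! i)"
      unfolding a by (intro sum.cong) auto
    ultimately show "l \<in> (\<lambda>a. \<Sum>i<\<rho>. A_emb \<iota> (a i) * ws ! i) ` (PiE {..<\<rho>} (\<lambda>_. ?D))"
      by blast
  qed
  then show ?thesis
    by (rule finite_subset) (intro finite_imageI finite_PiE finite_poly_degree_le finite_lessThan)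
qed

sublocale discrete_subspace \<iota> \<Lambda>
proof
  show "0 \<in> \<Lambda>"
    unfolding lattice_iff by (intro exI[of _ "\<lambda>_. 0"]) simp
  show "a - b \<in> \<Lambda>" if "a \<in> \<Lambda>" "b \<in> \<Lambda>" for a b
  proof -
    from that obtain c d where "a = (\<Sum>i<\<rho>. A_emb \<iota> (c i) * ws ! i)"
      "b = (\<Sum>i<\<rho>. A_emb \<iota> (d i) * ws ! i)" unfolding lattice_iff by blast
    then show ?thesis
      unfolding lattice_iff
      by (intro exI[of _ "\<lambda>i. c i - d i"]) (simp add: A_emb_diff left_diff_distrib sum_subtractf)
  qed
  show "\<sigma> c * a \<in> \<Lambda>" if "a \<in> \<Lambda>" for a c
  proof -
    from that obtain d where "a = (\<Sum>i<\<rho>. A_emb \<iota> (d i) * ws ! i)" unfolding lattice_iff by blast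
    then show ?thesis
      unfolding lattice_iff
      by (intro exI[of _ "\<lambda>i. Polynomial.smult c (d i)"])
        (simp add: A_emb_smult sum_distrib_left mult.assoc)
  qed
qed (rule finite_lattice_ball)

section \<open>The T-torsion and the polynomial \<phi>_T\<close>

definition comb :: "(nat \<Rightarrow> 'f) \<Rightarrow> 'c" where "comb c = (\<Sum>i<\<rho>. \<sigma> (c i) * ws ! i)"

definition B :: "'c set" where "B = comb ` PiE {..<\<rho>} (\<lambda>_. UNIV)"

definition u :: "nat \<Rightarrow> 'c" where "u i = ex (ws ! i / T)"

text \<open>\<open>B\<close> represents \<open>\<Lambda> / T\<Lambda>\<close>, so \<open>M\<close> is the \<open>T\<close>-torsion \<open>e(T\<^sup>-\<^sup>1\<Lambda>)\<close>.\<close>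

definition M :: "'c set" where "M = (\<lambda>r. ex (r / T)) ` B"

lemma comb_restrict: "comb (restrict c {..<\<rho>}) = comb c"
  unfolding comb_def by (intro sum.cong) auto

lemma comb_in_B: "comb c \<in> B"
proof -
  have "restrict c {..<\<rho>} \<in> PiE {..<\<rho>} (\<lambda>_. UNIV)" by auto
  then have "comb (restrict c {..<\<rho>}) \<in> B" unfolding B_def by blast
  then show ?thesis by (simp only: comb_restrict)
qed

lemma finite_B: "finite B"
  unfolding B_def by (intro finite_imageI finite_PiE) auto

lemma zero_in_B: "0 \<in> B"
  using comb_in_B[of "\<lambda>_. 0"] by (simp add: comb_def)

text \<open>\<open>pCons c a\<close> stands for c + T a, so the equation is a single linear relation
  over A.\<close>

lemma comb_plus_T_lattice_eq:
  assumes "comb c + T * (\<Sum>i<\<rho>. A_emb \<iota> (a i) * ws ! i) = comb d + T * (\<Sum>i<\<rho>. A_emb \<iota> (b i) * ws ! i)"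
    and i: "i < \<rho>"
  shows "c i = d i" "a i = b i"
proof -
  have "(\<Sum>i<\<rho>. A_emb \<iota> (pCons (c i) (a i) - pCons (d i) (b i)) * ws ! i) =
      comb c + T * (\<Sum>i<\<rho>. A_emb \<iota> (a i) * ws ! i) -
      (comb d + T * (\<Sum>i<\<rho>. A_emb \<iota> (b i) * ws ! i))"
    by (simp only: A_emb_diff A_emb_pCons comb_def sum_distrib_left sum.distrib[symmetric]
        sum_subtractf[symmetric]) (simp add: algebra_simps)
  also have "\<dots> = 0" using assms by simp
  finally have "pCons (c i) (a i) - pCons (d i) (b i) = 0"
    by (rule A_independent[OF _ i])
  then show "c i = d i" "a i = b i" by auto
qed

lemma bij_betw_lattice: "bij_betw (\<lambda>(r, l). r + T * l) (B \<times> \<Lambda>) \<Lambda>"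
  unfolding bij_betw_def
proof
  show "inj_on (\<lambda>(r, l). r + T * l) (B \<times> \<Lambda>)"
  proof (rule inj_onI, clarify)
    fix r l r' l' assume mem: "r \<in> B" "l \<in> \<Lambda>" "r' \<in> B" "l' \<in> \<Lambda>" and eq: "r + T * l = r' + T * l'"
    from mem obtain c a d b where r: "r = comb c" "r' = comb d"
      and l: "l = (\<Sum>i<\<rho>. A_emb \<iota> (a i) * ws ! i)" "l' = (\<Sum>i<\<rho>. A_emb \<iota> (b i) * ws ! i)"
      by (auto simp: B_def lattice_iff)
    have "c i = d i" "a i = b i" if "i < \<rho>" for i
      using comb_plus_T_lattice_eq[OF eq[unfolded r l] that] by auto
    then show "r = r' \<and> l = l'"
      unfolding r l comb_def by (auto intro!: sum.cong)
  qed
  show "(\<lambda>(r, l). r + T * l) ` (B \<times> \<Lambda>) = \<Lambda>"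
  proof (intro equalityI subsetI)
    fix x assume "x \<in> (\<lambda>(r, l). r + T * l) ` (B \<times> \<Lambda>)"
    then obtain c a where x: "x = comb c + T * (\<Sum>i<\<rho>. A_emb \<iota> (a i) * ws ! i)"
      by (auto simp: B_def lattice_iff)
    have "x = (\<Sum>i<\<rho>. A_emb \<iota> (pCons (c i) (a i)) * ws ! i)"
      unfolding x comb_def A_emb_pCons sum_distrib_left sum.distrib[symmetric]
      by (intro sum.cong) (auto simp: algebra_simps)
    then show "x \<in> \<Lambda>" unfolding lattice_iff by (rule exI[of _ "\<lambda>i. pCons (c i) (a i)"])
  next
    fix x assume "x \<in> \<Lambda>"
    then obtain a where a: "x = (\<Sum>i<\<rho>. A_emb \<iota> (a i) * ws ! i)" unfolding lattice_iff by blast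
    define c where "c i = coeff (a i) 0" for i
    define b where "b i = poly_shift 1 (a i)" for i
    have "a i = pCons (c i) (b i)" for i
      by (intro poly_eqI) (auto simp: c_def b_def coeff_pCons coeff_poly_shift split: nat.split)
    then have "x = comb c + T * (\<Sum>i<\<rho>. A_emb \<iota> (b i) * ws ! i)"
      unfolding a comb_def sum_distrib_left sum.distrib[symmetric]
      by (intro sum.cong) (auto simp: A_emb_pCons algebra_simps)
    moreover have "(\<Sum>i<\<rho>. A_emb \<iota> (b i) * ws ! i) \<in> \<Lambda>" unfolding lattice_iff by blast
    ultimately show "x \<in> (\<lambda>(r, l). r + T * l) ` (B \<times> \<Lambda>)"
      using comb_in_B[of c] by force
  qed
qed

lemma inj_on_exp_B: "inj_on (\<lambda>r. ex (r / T)) B"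
proof (rule inj_onI)
  fix r r' assume r: "r \<in> B" "r' \<in> B" "ex (r / T) = ex (r' / T)"
  then have "ex (r / T - r' / T) = 0" by (simp add: exp_diff)
  then have l: "r / T - r' / T \<in> \<Lambda>" by (simp add: exp_eq_0_iff)
  have "(r, 0) = (r', r / T - r' / T)"
    by (rule inj_onD[OF bij_betw_imp_inj_on[OF bij_betw_lattice]])
      (use r l zero_mem in \<open>auto simp: field_simps\<close>)
  then show "r = r'" by simp
qed

lemma card_M: "card M = q ^ \<rho>"
proof -
  have "inj_on comb (PiE {..<\<rho>} (\<lambda>_. UNIV))"
  proof (rule inj_onI)
    fix c d :: "nat \<Rightarrow> 'f" assume cd: "c \<in> PiE {..<\<rho>} (\<lambda>_. UNIV)" "d \<in> PiE {..<\<rho>} (\<lambda>_. UNIV)"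
      and eq: "comb c = comb d"
    show "c = d"
      using comb_plus_T_lattice_eq(1)[of c "\<lambda>_. 0" d "\<lambda>_. 0"] eq
      by (intro PiE_ext[OF cd]) auto
  qed
  then have "card B = q ^ \<rho>"
    unfolding B_def by (simp add: card_image card_PiE q_eq)
  then show ?thesis
    unfolding M_def by (simp add: card_image inj_on_exp_B)
qed

lemma finite_M: "finite M" by (simp add: M_def finite_B)

lemma zero_in_M: "0 \<in> M"
  unfolding M_def using zero_in_B by force

text \<open>The recursive form shows which exponents occur, the product form gives the functional
  equation. Both are monic of degree q^\<rho>, which is also the number of points of
  \<open>M\<close>, and vanish on \<open>M\<close>.\<close>

lemma span_poly_eq_prod: "Fq.span_poly u \<rho> = (\<Prod>m\<in>M. [:- m, 1:])"
proof (rule poly_eqI_degree_lead_coeff[where n = "q ^ \<rho>" and A = M])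
  have deg: "degree (\<Prod>m\<in>M. [:- m, 1:]) = q ^ \<rho>"
    by (subst degree_prod_sum_eq) (auto simp: card_M)
  moreover have "lead_coeff (\<Prod>m\<in>M. [:- m, 1:]) = 1"
    by (simp add: lead_coeff_prod)
  ultimately show "coeff (Fq.span_poly u \<rho>) (q ^ \<rho>) = coeff (\<Prod>m\<in>M. [:- m, 1:]) (q ^ \<rho>)"
    using Fq.monic_span_poly[of u \<rho>] by (simp add: Fq.degree_span_poly)
  show "degree (\<Prod>m\<in>M. [:- m, 1:]) \<le> q ^ \<rho>" by (simp add: deg)
  fix m assume m: "m \<in> M"
  then obtain c where "m = ex (comb c / T)" by (auto simp: M_def B_def)
  also have "comb c / T = (\<Sum>i<\<rho>. \<sigma> (c i) * (ws ! i / T))"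
    by (simp add: comb_def sum_divide_distrib)
  finally have "m = (\<Sum>i<\<rho>. \<sigma> (c i) * u i)"
    by (simp only: exp_sum exp_scale u_def)
  then have "poly (Fq.span_poly u \<rho>) m = 0"
    by (simp add: Fq.poly_span_poly_eq_0)
  moreover have "poly (\<Prod>m\<in>M. [:- m, 1:]) m = 0"
    using m finite_M by (auto simp: poly_prod)
  ultimately show "poly (Fq.span_poly u \<rho>) m = poly (\<Prod>m\<in>M. [:- m, 1:]) m" by simp
qed (simp_all add: card_M Fq.degree_span_poly)

text \<open>This is T X \<Prod>(1 - X/m) over the nonzero torsion points m, rescaled from the monic
  \<open>span_poly\<close>.\<close>

definition \<phi>T :: "'c poly" where
  "\<phi>T = Polynomial.smult (T / (\<Prod>m\<in>M-{0}. - m)) (Fq.span_poly u \<rho>)"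

lemma T_div_nonzero: "T / (\<Prod>m\<in>M-{0}. - m) \<noteq> 0"
  using T_nonzero prod_uminus_nonzero[OF finite_M] by simp

lemma poly_\<phi>T: "poly \<phi>T (ex z) = ex (T * z)"
proof -
  \<comment> \<open>The functional equation has factors m - e(z), the polynomial e(z) - m. The
    resulting sign \<open>s\<close> occurs in the numerator and in the normalizing constant and
    cancels.\<close>
  define s where "s = (\<Prod>m\<in>M-{0}. - 1 :: 'c)"
  have s: "s \<noteq> 0" by (simp add: s_def)
  have reindex: "(\<Prod>r\<in>B-{0}. g (ex (r / T))) = (\<Prod>m\<in>M-{0}. g m)" for g :: "'c \<Rightarrow> 'c"
  proof -
    have "M - {0} = (\<lambda>r. ex (r / T)) ` (B - {0})"
      unfolding M_def using inj_on_image_set_diff[OF inj_on_exp_B, of B "{0}"] zero_in_B by auto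
    moreover have "inj_on (\<lambda>r. ex (r / T)) (B - {0})"
      by (rule inj_on_subset[OF inj_on_exp_B]) auto
    ultimately show ?thesis by (simp add: prod.reindex)
  qed
  have sM: "(\<Prod>m\<in>M-{0}. - m) = s * (\<Prod>m\<in>M-{0}. m)"
    unfolding s_def prod.distrib[symmetric] by simp
  have "(\<Prod>m\<in>M-{0}. ex z - m) = (\<Prod>m\<in>M-{0}. - 1 * (m - ex z))"
    by (intro prod.cong) auto
  then have sD: "(\<Prod>m\<in>M-{0}. ex z - m) = s * (\<Prod>m\<in>M-{0}. m - ex z)"
    by (simp only: prod.distrib s_def)
  have nz: "(\<Prod>m\<in>M-{0}. m) \<noteq> 0" using finite_M by simp
  have "ex (T * z) * (\<Prod>m\<in>M-{0}. m) = T * ex z * (\<Prod>m\<in>M-{0}. m - ex z)"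
    using exp_functional_equation[OF finite_B zero_in_B bij_betw_lattice, of z]
    by (simp only: reindex[of "\<lambda>x. x"] reindex[of "\<lambda>x. x - ex z"])
  then have "ex (T * z) = T * ex z * (\<Prod>m\<in>M-{0}. m - ex z) / (\<Prod>m\<in>M-{0}. m)"
    using nz by (metis nonzero_mult_div_cancel_right)
  moreover have "poly (Fq.span_poly u \<rho>) (ex z) = ex z * (\<Prod>m\<in>M-{0}. ex z - m)"
    unfolding span_poly_eq_prod poly_prod
    using prod.remove[OF finite_M zero_in_M, of "\<lambda>m. ex z - m"] by simp
  ultimately show ?thesis
    using s nz by (simp add: \<phi>T_def sM sD)
qed

lemma qpoly_\<phi>T: "Fq.qpoly \<phi>T"
  unfolding \<phi>T_def by (intro Fq.qpoly_smult Fq.qpoly_span_poly)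

lemma degree_\<phi>T: "degree \<phi>T = q ^ \<rho>"
  using T_div_nonzero by (simp add: \<phi>T_def Fq.degree_span_poly)

lemma coeff_1_\<phi>T: "coeff \<phi>T 1 = T"
proof -
  have "Fq.span_poly u \<rho> = [:0, 1:] * (\<Prod>m\<in>M-{0}. [:- m, 1:])"
    unfolding span_poly_eq_prod by (subst prod.remove[OF finite_M zero_in_M]) simp
  then have "coeff (Fq.span_poly u \<rho>) 1 = poly (\<Prod>m\<in>M-{0}. [:- m, 1:]) 0"
    by (simp add: poly_0_coeff_0)
  also have "\<dots> = (\<Prod>m\<in>M-{0}. - m)" by (simp add: poly_prod)
  finally show ?thesis
    using prod_uminus_nonzero[OF finite_M] by (simp add: \<phi>T_def)
qed

section \<open>The Drinfeld module at an arbitrary polynomial\<close>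

lemma drinfeld_module_eqI:
  assumes "\<And>z. poly p (ex z) = ex (A_emb \<iota> a * z)"
  shows "drinfeld_module \<iota> \<Lambda> a = p"
  unfolding drinfeld_module_def
proof (rule the_equality)
  show "\<forall>z. poly p (ex z) = ex (A_emb \<iota> a * z)" using assms by blast
  fix p' assume p': "\<forall>z. poly p' (ex z) = ex (A_emb \<iota> a * z)"
  \<comment> \<open>Two candidates agree on the infinite image of the exponential, which settles the
    uniqueness demanded by \<open>THE\<close>.\<close>
  have "range ex \<subseteq> {x. poly (p' - p) x = 0}"
    using assms p' by auto
  then have "infinite {x. poly (p' - p) x = 0}"
    using infinite_range_exp finite_subset by blast
  then have "p' - p = 0" using poly_roots_finite by blast
  then show "p' = p" by simp
qed

abbreviation \<phi> :: "'f poly \<Rightarrow> 'c poly" where "\<phi> \<equiv> drinfeld_module \<iota> \<Lambda>"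

lemma \<phi>_T: "\<phi> [:0, 1:] = \<phi>T"
  by (rule drinfeld_module_eqI) (simp add: poly_\<phi>T A_emb_pCons \<iota>_one)

definition \<Delta> :: 'c where "\<Delta> = Discr \<iota> ws"

lemma \<Delta>_eq: "\<Delta> = lead_coeff \<phi>T"
  by (simp add: \<Delta>_def Discr_def g_coeff_def length_ws \<phi>_T degree_\<phi>T flip: q_eq)

lemma \<Delta>_nonzero: "\<Delta> \<noteq> 0"
proof -
  have "degree \<phi>T > 0" by (simp add: degree_\<phi>T)
  then show ?thesis by (auto simp: \<Delta>_eq)
qed

text \<open>Induction along the Horner scheme: passing from a to c + T a replaces the polynomial p
  by c X + p(\<phi>_T(X)).\<close>

lemma drinfeld_module_exists:
  "\<exists>p. (\<forall>z. poly p (ex z) = ex (A_emb \<iota> a * z)) \<and> Fq.qpoly p \<and>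
    (a \<noteq> 0 \<longrightarrow> degree p = q ^ (\<rho> * degree a) \<and>
      lead_coeff p = \<sigma> (lead_coeff a) * \<Delta> ^ ((q ^ (\<rho> * degree a) - 1) div (q ^ \<rho> - 1)))"
proof (induction a)
  case 0
  show ?case by (intro exI[of _ 0]) auto
next
  case (pCons c a)
  then obtain p where p: "\<And>z. poly p (ex z) = ex (A_emb \<iota> a * z)" "Fq.qpoly p"
    "a \<noteq> 0 \<Longrightarrow> degree p = q ^ (\<rho> * degree a)"
    "a \<noteq> 0 \<Longrightarrow>
      lead_coeff p = \<sigma> (lead_coeff a) * \<Delta> ^ ((q ^ (\<rho> * degree a) - 1) div (q ^ \<rho> - 1))"
    by blast
  define r where "r = [:0, \<sigma> c:] + pcompose p \<phi>T"
  have eval: "poly r (ex z) = ex (A_emb \<iota> (pCons c a) * z)" for z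
  proof -
    have "poly r (ex z) = ex (\<sigma> c * z) + ex (A_emb \<iota> a * (T * z))"
      by (simp add: r_def poly_pcompose poly_\<phi>T p(1) exp_scale mult.commute[of "ex z"])
    also have "\<dots> = ex (A_emb \<iota> (pCons c a) * z)"
      unfolding exp_add[symmetric] A_emb_pCons by (rule arg_cong[of _ _ ex]) (simp add: algebra_simps)
    finally show ?thesis .
  qed
  have qr: "Fq.qpoly r"
    unfolding r_def by (intro Fq.qpoly_add Fq.qpoly_linear Fq.qpoly_pcompose p qpoly_\<phi>T)
  show ?case
  proof (cases "a = 0")
    case True
    with pCons.hyps have c: "c \<noteq> 0" by auto
    have "A_emb \<iota> (pCons c a) = \<sigma> c" using True by (simp add: A_emb_pCons)
    with True c show ?thesis
      by (intro exI[of _ "[:0, \<sigma> c:]"]) (auto simp: exp_scale Fq.qpoly_linear mult.commute[of "ex _"])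
  next
    case False
    have "0 < \<rho> * Suc (degree a)" using \<rho>_pos by simp
    then have "1 < q ^ (\<rho> * Suc (degree a))"
      using Fq.q_ge2 by (intro one_less_power) auto
    moreover have "degree (pcompose p \<phi>T) = q ^ (\<rho> * Suc (degree a))"
      using p(3)[OF False] by (simp add: degree_pcompose degree_\<phi>T power_add)
    ultimately have less: "degree [:0, \<sigma> c:] < degree (pcompose p \<phi>T)"
      by (simp add: degree_pCons_eq_if)
    have deg: "degree r = q ^ (\<rho> * Suc (degree a))"
      unfolding r_def degree_add_eq_right[OF less] by fact
    let ?n = "q ^ (\<rho> * degree a)" and ?m = "q ^ \<rho> - 1"
    have m: "0 < ?m" using Fq.q_ge2 \<rho>_pos one_less_power[of q \<rho>] by simp
    \<comment> \<open>Composition with \<phi>_T multiplies the leading coefficient by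
      \<Delta>^(q^(\<rho> d)), d the degree of a; accordingly the exponent of \<Delta> grows by
      q^(\<rho> d) from d to d + 1.\<close>
    have "q ^ (\<rho> * Suc (degree a)) - 1 = (?n - 1) + ?n * ?m"
    proof -
      have "q ^ (\<rho> * Suc (degree a)) = ?n * q ^ \<rho>" by (simp add: power_add)
      moreover have "1 \<le> ?n" "1 \<le> q ^ \<rho>" by (simp_all add: Suc_le_eq)
      moreover from this have "?n \<le> ?n * q ^ \<rho>" by simp
      ultimately show ?thesis by (simp add: diff_mult_distrib2)
    qed
    then have expo: "(q ^ (\<rho> * Suc (degree a)) - 1) div ?m = (?n - 1) div ?m + ?n"
      using m by simp
    have "lead_coeff r = lead_coeff (pcompose p \<phi>T)"
      unfolding r_def by (rule lead_coeff_add_le[OF less])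
    also have "\<dots> = lead_coeff p * \<Delta> ^ ?n"
      using p(3)[OF False] lead_coeff_comp[of \<phi>T p] by (simp add: degree_\<phi>T \<Delta>_eq)
    also have "\<dots> = \<sigma> (lead_coeff a) * \<Delta> ^ ((?n - 1) div ?m + ?n)"
      using p(4)[OF False] by (simp add: power_add)
    also have "\<dots> = \<sigma> (lead_coeff a) * \<Delta> ^ ((q ^ (\<rho> * Suc (degree a)) - 1) div ?m)"
      by (simp only: expo)
    finally show ?thesis
      using eval qr deg False by (intro exI[of _ r]) (auto simp del: mult_Suc_right)
  qed
qed

lemma poly_\<phi>: "poly (\<phi> a) (ex z) = ex (A_emb \<iota> a * z)"
  and qpoly_\<phi>: "Fq.qpoly (\<phi> a)"
  and degree_\<phi>: "a \<noteq> 0 \<Longrightarrow> degree (\<phi> a) = q ^ (\<rho> * degree a)"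
  and lead_coeff_\<phi>: "a \<noteq> 0 \<Longrightarrow>
      lead_coeff (\<phi> a) = \<sigma> (lead_coeff a) * \<Delta> ^ ((q ^ (\<rho> * degree a) - 1) div (q ^ \<rho> - 1))"
  using drinfeld_module_exists[of a] drinfeld_module_eqI by blast+

lemma \<phi>_add: "\<phi> (a + b) = \<phi> a + \<phi> b"
  by (rule drinfeld_module_eqI) (simp add: poly_\<phi> A_emb_add distrib_right exp_add)

lemma \<phi>_smult: "\<phi> (Polynomial.smult c a) = Polynomial.smult (\<sigma> c) (\<phi> a)"
  by (rule drinfeld_module_eqI) (simp add: poly_\<phi> A_emb_smult mult.assoc exp_scale)

lemma \<phi>_1: "\<phi> 1 = [:0, 1:]"
  by (rule drinfeld_module_eqI) (simp add: one_pCons A_emb_pCons \<iota>_one)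

end

subsection \<open>Expansions in \<open>t\<close>\<close>

text \<open>Congruence to 1 modulo \<open>d\<close> is written as divisibility; with
  \<open>d\<close> a power of \<open>fps_X\<close> this is the form of the estimates for
  products.\<close>

lemma dvd_mult_minus_one:
  fixes d :: "'a::comm_ring_1"
  assumes "d dvd f - 1" "d dvd g - 1"
  shows "d dvd f * g - 1"
proof -
  have "f * g - 1 = f * (g - 1) + (f - 1)" by (simp add: algebra_simps)
  with assms show ?thesis by (metis dvd_add dvd_mult)
qed

lemma dvd_power_minus_one:
  fixes d :: "'a::comm_ring_1"
  shows "d dvd f - 1 \<Longrightarrow> d dvd f ^ n - 1"
  by (induction n) (auto intro: dvd_mult_minus_one)

lemma dvd_prod_minus_one:
  fixes d :: "'a::comm_ring_1"
  shows "(\<And>i. i \<in> I \<Longrightarrow> d dvd f i - 1) \<Longrightarrow> d dvd (\<Prod>i\<in>I. f i) - 1"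
  by (induction I rule: infinite_finite_induct) (auto intro: dvd_mult_minus_one)

lemma power_dvd_power_of_dvd:
  fixes x :: "'a::comm_semiring_1"
  assumes "x ^ m dvd f" "n \<le> m * k"
  shows "x ^ n dvd f ^ k"
proof -
  have "x ^ n dvd x ^ (m * k)" using assms(2) by (rule le_imp_power_dvd)
  also have "\<dots> dvd f ^ k" using dvd_power_same[OF assms(1)] by (simp add: power_mult)
  finally show ?thesis .
qed

lemma fps_nth_eq_of_dvd_diff:
  fixes f g :: "'a::comm_ring_1 fps"
  assumes "fps_X ^ m dvd f - g" "n < m"
  shows "fps_nth f n = fps_nth g n"
proof -
  obtain k where "f - g = fps_X ^ m * k" using assms(1) by (elim dvdE)
  then have "fps_nth (f - g) n = 0" using assms(2) by (simp add: fps_X_power_mult_nth)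
  then show ?thesis by simp
qed

text \<open>Since \<open>u\<close> has no constant term, the remainder after m terms is divisible by
  X^m and stops affecting coefficient n once m > n.\<close>

lemma fps_geometric_sums:
  fixes u :: "'a::field fps"
  assumes "fps_nth u 0 = 0"
  shows "(\<lambda>k. (- u) ^ k) sums inverse (1 + u)"
proof -
  have unit: "inverse (1 + u) * (1 + u) = 1"
    using assms by (intro inverse_mult_eq_1) simp
  have partial: "(\<Sum>k<n. (- u) ^ k) = inverse (1 + u) * (1 - (- u) ^ n)" for n
  proof -
    have "(1 + u) * (\<Sum>k<n. (- u) ^ k) = 1 - (- u) ^ n"
      by (induction n) (simp_all add: algebra_simps)
    then have "inverse (1 + u) * (1 - (- u) ^ n) = inverse (1 + u) * (1 + u) * (\<Sum>k<n. (- u) ^ k)"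
      by (simp add: mult.assoc)
    with unit show ?thesis by simp
  qed
  have "0 < subdegree u" if "u \<noteq> 0"
    using assms that by (metis gr0I nth_subdegree_nonzero)
  then have "fps_X ^ 1 dvd - u"
    by (cases "u = 0") (auto simp: fps_dvd_iff Suc_le_eq)
  then have dvd: "fps_X ^ n dvd (- u) ^ n" for n
    by (rule power_dvd_power_of_dvd) simp
  show ?thesis
    unfolding sums_def
  proof (rule tendsto_fpsI)
    fix n
    show "\<forall>\<^sub>F m in sequentially. fps_nth (\<Sum>k<m. (- u) ^ k) n = fps_nth (inverse (1 + u)) n"
      using eventually_gt_at_top[of n]
    proof eventually_elim
      case (elim m)
      have "(\<Sum>k<m. (- u) ^ k) - inverse (1 + u) = - inverse (1 + u) * (- u) ^ m"
        unfolding partial by (simp add: algebra_simps)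
      then have "fps_X ^ m dvd (\<Sum>k<m. (- u) ^ k) - inverse (1 + u)"
        using dvd[of m] by simp
      from fps_nth_eq_of_dvd_diff[OF this elim] show ?case .
    qed
  qed
qed

text \<open>This is X^Q p(1/X) when the degree of p is at most Q. Reversal at a fixed Q, not at the
  degree of p, is linear in p, so terms of lower degree can be split off.\<close>

definition rev_series :: "nat \<Rightarrow> 'a::comm_ring_1 poly \<Rightarrow> 'a fps" where
  "rev_series Q p = (\<Sum>i\<le>Q. fps_const (coeff p i) * fps_X ^ (Q - i))"

lemma rev_series_add: "rev_series Q (p + r) = rev_series Q p + rev_series Q r"
  by (simp add: rev_series_def distrib_right sum.distrib flip: fps_const_add)

lemma rev_series_smult: "rev_series Q (Polynomial.smult c p) = fps_const c * rev_series Q p"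
  by (simp add: rev_series_def sum_distrib_left mult.assoc flip: fps_const_mult)

lemma rev_series_X:
  assumes "1 \<le> Q"
  shows "rev_series Q [:0, 1:] = fps_X ^ (Q - 1)"
proof -
  have "rev_series Q [:0, 1:] = (\<Sum>i\<in>{1}. fps_const (coeff [:0, 1:] i) * fps_X ^ (Q - i))"
    unfolding rev_series_def
    by (rule sum.mono_neutral_right) (use assms in \<open>auto simp: coeff_pCons split: nat.splits\<close>)
  then show ?thesis by simp
qed

lemma fps_X_power_dvd_rev_series:
  assumes "degree p \<le> D"
  shows "fps_X ^ (Q - D) dvd rev_series Q p"
  unfolding rev_series_def
proof (rule dvd_sum)
  fix i
  show "fps_X ^ (Q - D) dvd fps_const (coeff p i) * fps_X ^ (Q - i)"
  proof (cases "i \<le> D")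
    case True
    then show ?thesis by (intro dvd_mult le_imp_power_dvd) simp
  next
    case False
    with assms have "coeff p i = 0" by (intro coeff_eq_0) simp
    then show ?thesis by simp
  qed
qed

lemma (in scalar_hom) rev_series_qpoly:
  assumes "qpoly p"
  shows "rev_series (q ^ n) p = (\<Sum>j\<le>n. fps_const (coeff p (q ^ j)) * fps_X ^ (q ^ n - q ^ j))"
proof -
  have inj: "inj_on (\<lambda>j. q ^ j) {..n}"
    using q_ge2 by (auto simp: inj_on_def)
  have "rev_series (q ^ n) p =
      (\<Sum>i\<in>(\<lambda>j. q ^ j) ` {..n}. fps_const (coeff p i) * fps_X ^ (q ^ n - i))"
    unfolding rev_series_def
  proof (rule sum.mono_neutral_right)
    show "(\<lambda>j. q ^ j) ` {..n} \<subseteq> {..q ^ n}"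
      using q_ge2 by (auto intro: power_increasing)
    show "\<forall>i\<in>{..q ^ n} - (\<lambda>j. q ^ j) ` {..n}. fps_const (coeff p i) * fps_X ^ (q ^ n - i) = 0"
    proof
      fix i assume i: "i \<in> {..q ^ n} - (\<lambda>j. q ^ j) ` {..n}"
      have "coeff p i = 0"
      proof (rule ccontr)
        assume "coeff p i \<noteq> 0"
        with assms obtain j where j: "i = q ^ j" by (auto simp: qpoly_def)
        with i have "j \<le> n" using q_ge2 by (auto simp: power_increasing_iff)
        with i j show False by auto
      qed
      then show "fps_const (coeff p i) * fps_X ^ (q ^ n - i) = 0" by simp
    qed
  qed simp
  then show ?thesis by (simp add: sum.reindex[OF inj])
qed

lemma (in scalar_hom) q_power_diff: "1 \<le> n \<Longrightarrow> q ^ n - q ^ (n - 1) = (q - 1) * q ^ (n - 1)"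
  by (cases n) (simp_all add: diff_mult_distrib)

section \<open>The series S_a modulo powers of t\<close>

context drinfeld_point
begin

abbreviation S :: "'f poly \<Rightarrow> 'c fps" where "S \<equiv> S_series \<iota> ws"

text \<open>Depends on the degree alone, so monic polynomials of equal degree share one
  normalization and their S_a differ by multiples of fixed series.\<close>

definition \<Delta>_pow :: "nat \<Rightarrow> 'c" where
  "\<Delta>_pow d = \<Delta> ^ ((q ^ (\<rho> * d) - 1) div (q ^ \<rho> - 1))"

lemma \<Delta>_pow_nonzero: "\<Delta>_pow d \<noteq> 0"
  by (simp add: \<Delta>_pow_def \<Delta>_nonzero)

lemma \<Delta>_pow_1: "\<Delta>_pow 1 = \<Delta>"
proof -
  have "0 < q ^ \<rho> - 1" using Fq.q_ge2 \<rho>_pos one_less_power[of q \<rho>] by simp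
  then show ?thesis by (simp add: \<Delta>_pow_def)
qed

lemma S_eq: "S a = fps_const (inverse (\<Delta>_pow (degree a))) *
    rev_series (q ^ (\<rho> * degree a)) (\<phi> a)"
  by (simp add: S_series_def Let_def length_ws rev_series_def \<Delta>_pow_def \<Delta>_def flip: q_eq)

lemma S_one: "S 1 = 1"
proof -
  have "S 1 = rev_series 1 [:0, 1:]"
    by (simp add: S_eq \<phi>_1 \<Delta>_pow_def)
  then show ?thesis by (simp add: rev_series_X)
qed

lemma S_minus_one_dvd:
  assumes "lead_coeff a = 1" "1 \<le> degree a"
  shows "fps_X ^ ((q - 1) * q ^ (\<rho> * degree a - 1)) dvd S a - 1"
proof -
  let ?n = "\<rho> * degree a" and ?k = "fps_const (inverse (\<Delta>_pow (degree a)))"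
  have a: "a \<noteq> 0" using assms by auto
  have n: "1 \<le> ?n" using \<rho>_pos assms by (simp add: Suc_le_eq)
  have "coeff (\<phi> a) (q ^ ?n) = \<Delta>_pow (degree a)"
    using lead_coeff_\<phi>[OF a] degree_\<phi>[OF a] assms by (simp add: \<Delta>_pow_def \<iota>_one)
  then have "?k * fps_const (coeff (\<phi> a) (q ^ ?n)) = 1"
    by (simp add: \<Delta>_pow_nonzero)
  moreover have "S a = ?k * (\<Sum>j\<le>?n. fps_const (coeff (\<phi> a) (q ^ j)) * fps_X ^ (q ^ ?n - q ^ j))"
    unfolding S_eq by (simp only: Fq.rev_series_qpoly[OF qpoly_\<phi>])
  moreover have "{..?n} = insert ?n {..<?n}" by auto
  ultimately have "S a - 1 =
      ?k * (\<Sum>j<?n. fps_const (coeff (\<phi> a) (q ^ j)) * fps_X ^ (q ^ ?n - q ^ j))"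
    by (simp add: distrib_left)
  \<comment> \<open>The top term is the 1; the next possible exponent of \<phi>_a is q^(n-1), and
    reversal turns this gap into the order of vanishing.\<close>
  also have "fps_X ^ (q ^ ?n - q ^ (?n - 1)) dvd \<dots>"
  proof (intro dvd_mult dvd_sum le_imp_power_dvd)
    fix j assume "j \<in> {..<?n}"
    then have "q ^ j \<le> q ^ (?n - 1)"
      using Fq.q_ge2 by (intro power_increasing) auto
    then show "q ^ ?n - q ^ (?n - 1) \<le> q ^ ?n - q ^ j" by simp
  qed
  finally show ?thesis by (simp only: Fq.q_power_diff[OF n])
qed

sublocale FP: scalar_hom "\<lambda>c. fps_const (\<sigma> c)" q
  by (rule Fq.scalar_hom_fps)

text \<open>The normalized reversal of \<phi>_1 = X, the effect of changing the constant term of a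
  monic polynomial of degree d; \<open>W 1\<close> is the W of the theorem.\<close>

definition W :: "nat \<Rightarrow> 'c fps" where
  "W d = fps_const (inverse (\<Delta>_pow d)) * fps_X ^ (q ^ (\<rho> * d) - 1)"

lemma W_dvd: "fps_X ^ (q ^ (\<rho> * d) - 1) dvd W d"
  by (simp add: W_def)

lemma S_degree_1: "S [:c, 1:] = S [:0, 1:] + fps_const (\<sigma> c) * W 1"
proof -
  have "[:c, 1:] = [:0, 1:] + Polynomial.smult c 1" by simp
  then have "\<phi> [:c, 1:] = \<phi> [:0, 1:] + Polynomial.smult (\<sigma> c) [:0, 1:]"
    by (metis \<phi>_1 \<phi>_add \<phi>_smult)
  then show ?thesis
    by (simp add: S_eq W_def rev_series_add rev_series_smult rev_series_X Suc_le_eq algebra_simps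
        del: smult_pCons)
qed

definition \<Pi>1 :: "'c fps" where
  "\<Pi>1 = S [:0, 1:] ^ q - S [:0, 1:] * W 1 ^ (q - 1)"

lemma prod_S_degree_1: "(\<Prod>c\<in>UNIV. S [:c, 1:]) = \<Pi>1"
proof -
  have "(\<Prod>c\<in>UNIV. S [:c, 1:]) = (\<Prod>c\<in>UNIV. S [:0, 1:] + fps_const (\<sigma> c) * W 1)"
    by (intro prod.cong refl S_degree_1)
  then show ?thesis by (simp only: FP.prod_add_scalar_multiples \<Pi>1_def)
qed

text \<open>Additivity of the q-th power gives (S_T - 1)^q the order bound (q-1) q^\<rho>, slightly
  better than needed; the exponent stated is the order of W^(q-1).\<close>

lemma \<Pi>1_minus_one_dvd: "fps_X ^ ((q ^ \<rho> - 1) * (q - 1)) dvd \<Pi>1 - 1"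
proof -
  have "\<Pi>1 - 1 = (S [:0, 1:] - 1) ^ q - S [:0, 1:] * W 1 ^ (q - 1)"
    by (simp add: \<Pi>1_def FP.power_q_diff)
  moreover have "fps_X ^ ((q ^ \<rho> - 1) * (q - 1)) dvd (S [:0, 1:] - 1) ^ q"
  proof (rule power_dvd_power_of_dvd[OF S_minus_one_dvd])
    have "q * q ^ (\<rho> - 1) = q ^ \<rho>"
      using \<rho>_pos by (metis power_minus_mult mult.commute)
    then have *: "(q - 1) * q ^ (\<rho> * degree [:0, 1:: 'f:] - 1) * q = (q - 1) * q ^ \<rho>"
      by (simp add: mult.assoc mult.commute[of q])
    show "(q ^ \<rho> - 1) * (q - 1) \<le> (q - 1) * q ^ (\<rho> * degree [:0, 1:: 'f:] - 1) * q"
      unfolding * by (subst mult.commute) (intro mult_le_mono2 diff_le_self)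
  qed simp_all
  moreover have "fps_X ^ ((q ^ \<rho> - 1) * (q - 1)) dvd W 1 ^ (q - 1)"
    by (rule power_dvd_power_of_dvd[OF W_dvd]) simp
  ultimately show ?thesis by (simp add: dvd_diff)
qed

lemma \<Pi>1_nth_0: "fps_nth \<Pi>1 0 = 1"
proof -
  have "0 < (q ^ \<rho> - 1) * (q - 1)"
    using Fq.q_ge2 \<rho>_pos one_less_power[of q \<rho>] by simp
  from fps_nth_eq_of_dvd_diff[OF \<Pi>1_minus_one_dvd this] show ?thesis by simp
qed

text \<open>As the power is additive, \<Pi>(1)^(q^r) - 1 = (\<Pi>(1) - 1)^(q^r) with r = \<rho> + 1,
  so the order is multiplied by q^r.\<close>

lemma \<Pi>1_power_minus_one_dvd:
  "fps_X ^ ((q - 1) * (q ^ (2 * \<rho> + 1) - q ^ (\<rho> + 1))) dvd \<Pi>1 ^ (q ^ (\<rho> + 1)) - 1"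
proof -
  have "\<Pi>1 ^ (q ^ (\<rho> + 1)) - 1 = (\<Pi>1 - 1) ^ (q ^ (\<rho> + 1))"
    using FP.power_q_power_add[of "\<Pi>1 - 1" 1 "\<rho> + 1"] by (simp del: power_Suc)
  moreover have "fps_X ^ ((q - 1) * (q ^ (2 * \<rho> + 1) - q ^ (\<rho> + 1))) dvd (\<Pi>1 - 1) ^ (q ^ (\<rho> + 1))"
  proof (rule power_dvd_power_of_dvd[OF \<Pi>1_minus_one_dvd])
    have "q ^ (2 * \<rho> + 1) = q ^ \<rho> * q ^ (\<rho> + 1)"
      by (simp only: power_add[symmetric]) (simp add: mult_2)
    then have "q ^ (2 * \<rho> + 1) - q ^ (\<rho> + 1) = (q ^ \<rho> - 1) * q ^ (\<rho> + 1)"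
      by (simp only: diff_mult_distrib mult_1)
    then show "(q - 1) * (q ^ (2 * \<rho> + 1) - q ^ (\<rho> + 1)) \<le> (q ^ \<rho> - 1) * (q - 1) * q ^ (\<rho> + 1)"
      by (simp only: mult_ac order_refl)
  qed
  ultimately show ?thesis by simp
qed

text \<open>The effect of changing the coefficient of T in a monic polynomial of degree 2: \<phi>_T,
  of degree q^\<rho>, reversed at q^(2\<rho>).\<close>

definition V :: "'c fps" where
  "V = fps_const (inverse (\<Delta>_pow 2)) * rev_series (q ^ (\<rho> * 2)) (\<phi> [:0, 1:])"

lemma S_degree_2:
  "S [:c, d, 1:] = (S [:0, 0, 1:] + fps_const (\<sigma> d) * V) + fps_const (\<sigma> c) * W 2"
proof -
  have "[:c, d, 1:] = [:0, 0, 1:] + Polynomial.smult d [:0, 1:] + Polynomial.smult c 1" by simp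
  then have "\<phi> [:c, d, 1:] = \<phi> [:0, 0, 1:] + Polynomial.smult (\<sigma> d) (\<phi> [:0, 1:]) +
      Polynomial.smult (\<sigma> c) [:0, 1:]"
    by (metis \<phi>_1 \<phi>_add \<phi>_smult)
  then show ?thesis
    by (simp add: S_eq W_def V_def rev_series_add rev_series_smult rev_series_X Suc_le_eq
        numeral_2_eq_2 algebra_simps del: smult_pCons)
qed

text \<open>
  Multiplying first over \<open>c\<close> and then over \<open>d\<close> in \<open>T\<^sup>2 + d T + c\<close> gives \<open>L(S)\<^sup>q - L(S) L(V)\<^sup>q\<^sup>-\<^sup>1\<close>
  with the \<open>F\<^sub>q\<close>-linear map \<open>L(x) = x\<^sup>q - x W\<^sup>q\<^sup>-\<^sup>1\<close>. The individual factors are not close enough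
  to \<open>1\<close>.
\<close>

lemma prod_S_degree_2_dvd:
  "fps_X ^ ((q - 1) * (q ^ (2 * \<rho> + 1) - q ^ (\<rho> + 1))) dvd
    (\<Prod>d\<in>UNIV. \<Prod>c\<in>UNIV. S [:c, d, 1:]) - 1"
proof -
  let ?N = "(q - 1) * (q ^ (2 * \<rho> + 1) - q ^ (\<rho> + 1))"
  define L where "L x = x ^ q - x * W 2 ^ (q - 1)" for x
  define s where "s = S [:0, 0, 1:]"
  have L_add: "L (x + fps_const (\<sigma> d) * y) = L x + fps_const (\<sigma> d) * L y" for x y d
    by (simp add: L_def FP.power_q_add power_mult_distrib Fq.hom_power_q algebra_simps)
  have "(\<Prod>d\<in>UNIV. \<Prod>c\<in>UNIV. S [:c, d, 1:]) =
      (\<Prod>d\<in>UNIV. \<Prod>c\<in>UNIV. (s + fps_const (\<sigma> d) * V) + fps_const (\<sigma> c) * W 2)"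
    unfolding s_def by (intro prod.cong refl S_degree_2)
  also have "\<dots> = (\<Prod>d\<in>UNIV. L s + fps_const (\<sigma> d) * L V)"
    by (simp only: FP.prod_add_scalar_multiples L_add[symmetric]) (simp only: L_def)
  also have "\<dots> = L s ^ q - L s * L V ^ (q - 1)"
    by (rule FP.prod_add_scalar_multiples)
  finally have prod: "(\<Prod>d\<in>UNIV. \<Prod>c\<in>UNIV. S [:c, d, 1:]) = L s ^ q - L s * L V ^ (q - 1)" .
  \<comment> \<open>The additive power q^2 is moved onto s - 1, whose order bound is thereby
    multiplied by q^2; what remains carries a high power of W.\<close>
  have "L s ^ q - 1 = (s - 1) ^ (q ^ 2) - s ^ q * (W 2 ^ (q - 1)) ^ q"
  proof -
    have "s ^ (q ^ 2) = (s - 1) ^ (q ^ 2) + 1"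
      using FP.power_q_power_add[of "s - 1" 1 2] by simp
    moreover have "L s ^ q = s ^ (q ^ 2) - s ^ q * (W 2 ^ (q - 1)) ^ q"
      unfolding L_def FP.power_q_diff power_mult_distrib[of s] power2_eq_square power_mult[of s] ..
    ultimately show ?thesis by simp
  qed
  moreover have "fps_X ^ ?N dvd (s - 1) ^ (q ^ 2)"
  proof (rule power_dvd_power_of_dvd)
    have "degree [:0, 0, 1 :: 'f:] = 2" "lead_coeff [:0, 0, 1 :: 'f:] = 1" by simp_all
    then show "fps_X ^ ((q - 1) * q ^ (\<rho> * 2 - 1)) dvd s - 1"
      unfolding s_def using S_minus_one_dvd[of "[:0, 0, 1:]"] by (simp add: mult.commute[of \<rho>] mult_2)
    have "\<rho> * 2 - 1 + 2 = 2 * \<rho> + 1" using \<rho>_pos by simp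
    then have "(q - 1) * q ^ (\<rho> * 2 - 1) * q ^ 2 = (q - 1) * q ^ (2 * \<rho> + 1)"
      by (simp only: mult.assoc power_add[symmetric])
    then show "?N \<le> (q - 1) * q ^ (\<rho> * 2 - 1) * q ^ 2"
      by (simp only: mult_le_mono2 diff_le_self)
  qed
  moreover have W_pow: "fps_X ^ ((q ^ (\<rho> * 2) - 1) * (q - 1)) dvd W 2 ^ (q - 1)"
    by (rule power_dvd_power_of_dvd[OF W_dvd]) simp
  have "fps_X ^ ?N dvd (W 2 ^ (q - 1)) ^ q"
  proof (rule power_dvd_power_of_dvd[OF W_pow])
    have "q \<le> q ^ (\<rho> + 1)" by (simp add: Suc_le_eq)
    then have "?N \<le> (q - 1) * (q ^ (2 * \<rho> + 1) - q)"
      by (intro mult_le_mono2 diff_le_mono2)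
    also have "q ^ (2 * \<rho> + 1) - q = (q ^ (\<rho> * 2) - 1) * q"
      by (simp add: diff_mult_distrib2 mult_ac)
    also have "(q - 1) * \<dots> = (q ^ (\<rho> * 2) - 1) * (q - 1) * q"
      by (simp only: mult_ac)
    finally show "?N \<le> (q ^ (\<rho> * 2) - 1) * (q - 1) * q" .
  qed
  ultimately have Ls: "fps_X ^ ?N dvd L s ^ q - 1"
    by (simp add: dvd_diff)
  have V_dvd: "fps_X ^ (q ^ (\<rho> * 2) - q ^ \<rho>) dvd V"
    unfolding V_def by (intro dvd_mult fps_X_power_dvd_rev_series) (simp add: \<phi>_T degree_\<phi>T)
  \<comment> \<open>The order of W is at least the bound known for V, so V W^(q-1) satisfies the
    same bound as V^q.\<close>
  have "fps_X ^ ((q ^ (\<rho> * 2) - q ^ \<rho>) * q) dvd V * W 2 ^ (q - 1)"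
  proof -
    have "(q ^ (\<rho> * 2) - q ^ \<rho>) * q =
        (q ^ (\<rho> * 2) - q ^ \<rho>) + (q ^ (\<rho> * 2) - q ^ \<rho>) * (q - 1)"
      using Fq.q_pos by (cases q) auto
    also have "\<dots> \<le> (q ^ (\<rho> * 2) - q ^ \<rho>) + (q ^ (\<rho> * 2) - 1) * (q - 1)"
      by (intro add_left_mono mult_right_mono diff_le_mono2) (auto simp: Suc_le_eq)
    finally have "fps_X ^ ((q ^ (\<rho> * 2) - q ^ \<rho>) * q) dvd
        (fps_X ^ ((q ^ (\<rho> * 2) - q ^ \<rho>) + (q ^ (\<rho> * 2) - 1) * (q - 1)) :: 'c fps)"
      by (rule le_imp_power_dvd)
    also have "\<dots> dvd V * W 2 ^ (q - 1)"
      unfolding power_add by (rule mult_dvd_mono[OF V_dvd W_pow])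
    finally show ?thesis .
  qed
  moreover have "fps_X ^ ((q ^ (\<rho> * 2) - q ^ \<rho>) * q) dvd V ^ q"
    by (rule power_dvd_power_of_dvd[OF V_dvd]) simp
  ultimately have "fps_X ^ ((q ^ (\<rho> * 2) - q ^ \<rho>) * q) dvd L V"
    unfolding L_def by (intro dvd_diff)
  then have "fps_X ^ ?N dvd L V ^ (q - 1)"
  proof (rule power_dvd_power_of_dvd)
    \<comment> \<open>The two sides of the required inequality are equal: this term has nothing to
      spare.\<close>
    have "q ^ (2 * \<rho> + 1) - q ^ (\<rho> + 1) = (q ^ (\<rho> * 2) - q ^ \<rho>) * q"
      by (simp add: diff_mult_distrib2 mult_ac)
    then show "?N \<le> (q ^ (\<rho> * 2) - q ^ \<rho>) * q * (q - 1)"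
      by (simp only: mult_ac order_refl)
  qed
  from dvd_diff[OF Ls dvd_mult[OF this, of "L s"]] show ?thesis unfolding prod by (simp add: algebra_simps)
qed

text \<open>For degree d \<ge> 3 and \<rho> \<ge> 2 one has \<rho> d - 1 \<ge> 3 \<rho> - 1 \<ge> 2
  \<rho> + 1, so each factor is close enough to 1 by itself.\<close>

lemma S_degree_ge_3_dvd:
  assumes "lead_coeff a = 1" "3 \<le> degree a" "2 \<le> \<rho>"
  shows "fps_X ^ ((q - 1) * (q ^ (2 * \<rho> + 1) - q ^ (\<rho> + 1))) dvd S a - 1"
proof -
  have "\<rho> * 3 \<le> \<rho> * degree a" using assms by simp
  then have "2 * \<rho> + 1 \<le> \<rho> * degree a - 1" using assms by linarith
  then have "q ^ (2 * \<rho> + 1) \<le> q ^ (\<rho> * degree a - 1)"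
    using Fq.q_ge2 by (intro power_increasing) auto
  then have "(q - 1) * (q ^ (2 * \<rho> + 1) - q ^ (\<rho> + 1)) \<le> (q - 1) * q ^ (\<rho> * degree a - 1)"
    by (intro mult_le_mono2) simp
  from le_imp_power_dvd[OF this] S_minus_one_dvd show ?thesis
    using assms by (meson dvd_trans le_trans one_le_numeral)
qed

text \<open>After division by \<Delta> the top coefficient of \<phi>_T becomes 1, while index 0
  carries its linear coefficient T.\<close>

lemma S_T_eq:
  assumes "2 \<le> \<rho>"
  shows "S [:0, 1:] = 1 +
    (\<Sum>i=1..\<rho> - 1. fps_const (g_coeff \<iota> i ws / \<Delta>) * fps_X ^ (q ^ \<rho> - q ^ i)) +
    fps_const (A_emb \<iota> [:0, 1:] / \<Delta>) * fps_X ^ (q ^ \<rho> - 1)"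
proof -
  let ?t = "\<lambda>j. fps_const (inverse \<Delta>) * (fps_const (coeff \<phi>T (q ^ j)) * fps_X ^ (q ^ \<rho> - q ^ j))"
  have const: "fps_const (inverse \<Delta>) * (fps_const c * f) = fps_const (c / \<Delta>) * f" for c f
    by (simp only: mult.assoc[symmetric] fps_const_mult divide_inverse mult.commute[of c])
  have "S [:0, 1:] = (\<Sum>j\<le>\<rho>. ?t j)"
    using \<Delta>_pow_1 by (simp add: S_eq \<phi>_T Fq.rev_series_qpoly[OF qpoly_\<phi>T] sum_distrib_left)
  also have "{..\<rho>} = insert 0 (insert \<rho> {1..\<rho> - 1})" using assms by auto
  also have "(\<Sum>j\<in>insert 0 (insert \<rho> {1..\<rho> - 1}). ?t j) = ?t \<rho> + (\<Sum>j=1..\<rho> - 1. ?t j) + ?t 0"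
    using assms by (simp add: add_ac)
  also have "?t \<rho> = 1"
    using \<Delta>_eq \<Delta>_nonzero by (simp add: degree_\<phi>T)
  also have "?t 0 = fps_const (A_emb \<iota> [:0, 1:] / \<Delta>) * fps_X ^ (q ^ \<rho> - 1)"
    using coeff_1_\<phi>T by (simp add: const A_emb_pCons \<iota>_one)
  also have "(\<Sum>j=1..\<rho> - 1. ?t j) =
      (\<Sum>i=1..\<rho> - 1. fps_const (g_coeff \<iota> i ws / \<Delta>) * fps_X ^ (q ^ \<rho> - q ^ i))"
    by (intro sum.cong refl) (simp add: const g_coeff_def \<phi>_T flip: q_eq)
  finally show ?thesis .
qed

end

section \<open>The product over all monic polynomials\<close>

lemma monic_degree_0: "lead_coeff a = 1 \<and> degree a = 0 \<longleftrightarrow> a = (1 :: 'a::comm_semiring_1 poly)"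
  by (auto elim!: degree_eq_zeroE simp: one_pCons)

lemma monic_degree_1: "{a :: 'a::comm_semiring_1 poly. lead_coeff a = 1 \<and> degree a = 1} = range (\<lambda>c. [:c, 1:])"
proof (intro equalityI subsetI)
  fix a :: "'a poly" assume "a \<in> {a. lead_coeff a = 1 \<and> degree a = 1}"
  then have "a = [:coeff a 0, 1:]"
    by (intro poly_eqI) (auto simp: coeff_pCons coeff_eq_0 split: nat.splits)
  then show "a \<in> range (\<lambda>c. [:c, 1:])" by blast
qed auto

lemma monic_degree_2:
  "{a :: 'a::comm_semiring_1 poly. lead_coeff a = 1 \<and> degree a = 2} = (\<lambda>(d, c). [:c, d, 1:]) ` UNIV"
proof (intro equalityI subsetI)
  fix a :: "'a poly" assume "a \<in> {a. lead_coeff a = 1 \<and> degree a = 2}"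
  then have "a = [:coeff a 0, coeff a 1, 1:]"
    by (intro poly_eqI) (auto simp: coeff_pCons coeff_eq_0 numeral_2_eq_2 split: nat.splits)
  then show "a \<in> (\<lambda>(d, c). [:c, d, 1:]) ` UNIV"
    by (intro image_eqI[of _ _ "(coeff a 1, coeff a 0)"]) auto
qed auto

context drinfeld_point
begin

text \<open>The bound is the same for every finite set containing the monic polynomials of degree at
  most 2, so it survives in the infinite product.\<close>

lemma prod_S_dvd:
  assumes \<rho>: "2 \<le> \<rho>"
    and F: "finite F" "{a. lead_coeff a = 1 \<and> degree a \<le> 2} \<subseteq> F" "F \<subseteq> {a. lead_coeff a = 1}"
  shows "fps_X ^ ((q - 1) * (q ^ (2 * \<rho> + 1) - q ^ (\<rho> + 1))) dvd
    (\<Prod>a\<in>F. S a ^ (q ^ (\<rho> + 1) - 1)) - inverse \<Pi>1"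
proof -
  let ?N = "(q - 1) * (q ^ (2 * \<rho> + 1) - q ^ (\<rho> + 1))" and ?E = "q ^ (\<rho> + 1) - 1"
  define A where "A d = {a :: 'f poly. lead_coeff a = 1 \<and> degree a = d}" for d
  define G where "G = F - (A 0 \<union> A 1 \<union> A 2)"
  have "A d \<subseteq> F" if "d \<le> 2" for d
    using F(2) that by (auto simp: A_def)
  then have sub: "A 0 \<subseteq> F" "A 1 \<subseteq> F" "A 2 \<subseteq> F" by auto
  then have fin: "finite (A 0)" "finite (A 1)" "finite (A 2)"
    using F(1) finite_subset by blast+
  have "F = (A 0 \<union> A 1 \<union> A 2) \<union> G" using sub by (auto simp: G_def)
  then have "(\<Prod>a\<in>F. S a) = (\<Prod>a\<in>(A 0 \<union> A 1 \<union> A 2) \<union> G. S a)" by simp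
  also have "\<dots> = (\<Prod>a\<in>A 0 \<union> A 1 \<union> A 2. S a) * (\<Prod>a\<in>G. S a)"
    by (rule prod.union_disjoint) (use fin F(1) in \<open>auto simp: G_def\<close>)
  also have "(\<Prod>a\<in>A 0 \<union> A 1 \<union> A 2. S a) = (\<Prod>a\<in>A 0 \<union> A 1. S a) * (\<Prod>a\<in>A 2. S a)"
    by (rule prod.union_disjoint) (use fin in \<open>auto simp: A_def\<close>)
  also have "(\<Prod>a\<in>A 0 \<union> A 1. S a) = (\<Prod>a\<in>A 0. S a) * (\<Prod>a\<in>A 1. S a)"
    by (rule prod.union_disjoint) (use fin in \<open>auto simp: A_def\<close>)
  also have "(\<Prod>a\<in>A 0. S a) = 1"
    by (simp add: A_def monic_degree_0 S_one)
  also have "(\<Prod>a\<in>A 1. S a) = \<Pi>1"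
  proof -
    have "inj (\<lambda>c :: 'f. [:c, 1:])" by (auto simp: inj_on_def)
    then show ?thesis
      unfolding A_def monic_degree_1 by (simp add: prod.reindex prod_S_degree_1)
  qed
  also have "(\<Prod>a\<in>A 2. S a) = (\<Prod>d\<in>UNIV. \<Prod>c\<in>UNIV. S [:c, d, 1:])"
  proof -
    have "inj (\<lambda>(d, c :: 'f). [:c, d, 1:])" by (auto simp: inj_on_def)
    then have "(\<Prod>a\<in>A 2. S a) = (\<Prod>(d, c)\<in>UNIV \<times> UNIV. S [:c, d, 1:])"
      unfolding A_def monic_degree_2 by (subst prod.reindex) (auto simp: case_prod_unfold)
    then show ?thesis by (simp only: prod.cartesian_product)
  qed
  finally have prod: "(\<Prod>a\<in>F. S a) =
      \<Pi>1 * ((\<Prod>d\<in>UNIV. \<Prod>c\<in>UNIV. S [:c, d, 1:]) * (\<Prod>a\<in>G. S a))"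
    by (simp add: mult.assoc)
  define R where "R = (\<Prod>d\<in>UNIV. \<Prod>c\<in>UNIV. S [:c, d, 1:]) * (\<Prod>a\<in>G. S a)"
  have "fps_X ^ ?N dvd S a - 1" if "a \<in> G" for a
  proof (rule S_degree_ge_3_dvd)
    have "a \<notin> A 0" "a \<notin> A 1" "a \<notin> A 2" and lc: "lead_coeff a = 1"
      using that F(3) by (auto simp: G_def)
    then have "degree a \<noteq> 0" "degree a \<noteq> 1" "degree a \<noteq> 2" by (auto simp: A_def)
    then show "3 \<le> degree a" by linarith
    show "lead_coeff a = 1" by (rule lc)
  qed (rule \<rho>)
  then have R: "fps_X ^ ?N dvd R - 1"
    unfolding R_def by (intro dvd_mult_minus_one prod_S_degree_2_dvd dvd_prod_minus_one)
  have inv: "inverse \<Pi>1 * \<Pi>1 = 1"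
    by (rule inverse_mult_eq_1) (simp add: \<Pi>1_nth_0)
  have pow: "\<Pi>1 ^ ?E * \<Pi>1 = \<Pi>1 ^ (q ^ (\<rho> + 1))"
    by (rule power_minus_mult) simp
  have "inverse \<Pi>1 * \<Pi>1 ^ (q ^ (\<rho> + 1)) = (inverse \<Pi>1 * \<Pi>1) * \<Pi>1 ^ ?E"
    unfolding pow[symmetric] by (simp only: mult_ac)
  then have "\<Pi>1 ^ ?E = inverse \<Pi>1 * \<Pi>1 ^ (q ^ (\<rho> + 1))"
    by (simp only: inv mult_1)
  then have "(\<Prod>a\<in>F. S a ^ ?E) - inverse \<Pi>1 =
      inverse \<Pi>1 * (\<Pi>1 ^ (q ^ (\<rho> + 1)) * R ^ ?E - 1)"
    by (simp only: prod_power_distrib[symmetric] prod R_def[symmetric] power_mult_distrib)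
      (simp add: algebra_simps)
  moreover have "fps_X ^ ?N dvd \<Pi>1 ^ (q ^ (\<rho> + 1)) * R ^ ?E - 1"
    by (intro dvd_mult_minus_one \<Pi>1_power_minus_one_dvd dvd_power_minus_one R)
  ultimately show ?thesis by simp
qed

text \<open>Power series converge coefficientwise, with each coefficient eventually constant, so one
  finite set attains the n-th coefficient of the limit. The factor \<open>fps_X\<close> raises the
  precision by the final 1 in N.\<close>

lemma limit_nth_eq:
  assumes \<rho>: "2 \<le> \<rho>"
    and lim: "((\<lambda>F. fps_const k * fps_X * (\<Prod>a\<in>F. S a ^ (q ^ (\<rho> + 1) - 1))) \<longlongrightarrow> P)
      (finite_subsets_at_top {a. lead_coeff a = 1})"
    and n: "n < (q - 1) * (q ^ (2 * \<rho> + 1) - q ^ (\<rho> + 1)) + 1"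
  shows "fps_nth P n = fps_nth (fps_const k * fps_X * inverse \<Pi>1) n"
proof -
  let ?N = "(q - 1) * (q ^ (2 * \<rho> + 1) - q ^ (\<rho> + 1))" and ?M = "{a :: 'f poly. lead_coeff a = 1}"
  let ?F0 = "{a :: 'f poly. lead_coeff a = 1 \<and> degree a \<le> 2}"
  have F0: "finite ?F0"
    by (rule finite_subset[OF _ finite_poly_degree_le[of 2]]) auto
  have "\<forall>\<^sub>F F in finite_subsets_at_top ?M. finite F \<and> ?F0 \<subseteq> F \<and> F \<subseteq> ?M"
    unfolding eventually_finite_subsets_at_top using F0 by (intro exI[of _ ?F0]) auto
  moreover have "\<forall>\<^sub>F F in finite_subsets_at_top ?M.
      fps_nth (fps_const k * fps_X * (\<Prod>a\<in>F. S a ^ (q ^ (\<rho> + 1) - 1))) n = fps_nth P n"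
    using lim unfolding tendsto_fps_iff by blast
  ultimately have "\<forall>\<^sub>F F in finite_subsets_at_top ?M. (finite F \<and> ?F0 \<subseteq> F \<and> F \<subseteq> ?M) \<and>
      fps_nth (fps_const k * fps_X * (\<Prod>a\<in>F. S a ^ (q ^ (\<rho> + 1) - 1))) n = fps_nth P n"
    by (rule eventually_conj)
  from eventually_happens'[OF finite_subsets_at_top_neq_bot this]
  obtain F where F: "finite F" "?F0 \<subseteq> F" "F \<subseteq> ?M"
    and nth: "fps_nth (fps_const k * fps_X * (\<Prod>a\<in>F. S a ^ (q ^ (\<rho> + 1) - 1))) n = fps_nth P n"
    by (elim exE conjE)
  have "fps_X ^ (?N + 1) = fps_X * (fps_X ^ ?N :: 'c fps)"
    using power_Suc[of "fps_X :: 'c fps" ?N] by (simp only: Suc_eq_plus1)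
  also have "\<dots> dvd fps_const k * (fps_X *
      ((\<Prod>a\<in>F. S a ^ (q ^ (\<rho> + 1) - 1)) - inverse \<Pi>1))"
    by (rule dvd_mult[OF mult_dvd_mono[OF dvd_refl prod_S_dvd[OF \<rho> F]]])
  finally have "fps_X ^ (?N + 1) dvd fps_const k * fps_X * (\<Prod>a\<in>F. S a ^ (q ^ (\<rho> + 1) - 1)) -
      fps_const k * fps_X * inverse \<Pi>1"
    by (simp only: right_diff_distrib mult.assoc)
  from fps_nth_eq_of_dvd_diff[OF this n] nth show ?thesis by simp
qed

end

text \<open>A series over the holomorphic functions is a family of series indexed by \<omega>', so
  coefficients are compared at one fixed \<omega>', with \<rho> = r - 1.\<close>

theorem theorem4p5:
  fixes \<iota> :: "'f::{finite,field} fls \<Rightarrow> 'c::{alg_closed_field,complete_space}"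
    and q r :: nat
    and h h' :: "'c list \<Rightarrow> 'c"
    and P :: "'c list \<Rightarrow> 'c fps"
  assumes C_inf: "completed_algebraic_closure \<iota>"
    and q: "q = CARD('f)"
    and r: "3 \<le> r"
    and h'_form: "modular_form \<iota> (r - 1) ((q ^ (r - 1) - 1) div (q - 1)) 1 h'"
    and h'_root: "\<forall>ws\<in>Omega \<iota> (r - 1). h' ws ^ (q - 1) = (- 1) ^ (r - 2) * Discr \<iota> ws"
    and h_form: "modular_form \<iota> r ((q ^ r - 1) div (q - 1)) 1 h"
    and h_root: "\<forall>ws\<in>Omega \<iota> r. h ws ^ (q - 1) = (- 1) ^ (r - 1) * Discr \<iota> ws"
    and h_expansion: "has_t_expansion \<iota> r h P"
    and h_normalized: "\<forall>ws\<in>Omega \<iota> (r - 1).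
      ((\<lambda>F. fps_const (h' ws ^ q) * fps_X * (\<Prod>a\<in>F. S_series \<iota> ws a ^ (q ^ r - 1)))
        \<longlongrightarrow> P ws) (finite_subsets_at_top {a. lead_coeff a = 1})"
  shows "\<forall>ws\<in>Omega \<iota> (r - 1).
    let g = (\<lambda>i. g_coeff \<iota> i ws);
        \<Delta>' = Discr \<iota> ws;
        T = A_emb \<iota> [:0, 1:];
        S\<^sub>T = 1 + (\<Sum>i=1..r-2. fps_const (g i / \<Delta>') * fps_X ^ (q ^ (r - 1) - q ^ i))
               + fps_const (T / \<Delta>') * fps_X ^ (q ^ (r - 1) - 1);
        W = fps_const (inverse \<Delta>') * fps_X ^ (q ^ (r - 1) - 1);
        \<Pi>\<^sub>1 = S\<^sub>T ^ q - S\<^sub>T * W ^ (q - 1);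
        U = \<Pi>\<^sub>1 - 1;
        N = (q - 1) * (q ^ (2 * r - 1) - q ^ r) + 1
    in S_series \<iota> ws [:0, 1:] = S\<^sub>T \<and>
       (\<lambda>k. (- U) ^ k) sums inverse \<Pi>\<^sub>1 \<and>
       (\<forall>n<N. fps_nth (P ws) n = fps_nth (fps_const (h' ws ^ q) * fps_X * inverse \<Pi>\<^sub>1) n)"
proof
  fix ws assume ws: "ws \<in> Omega \<iota> (r - 1)"
  define \<rho> where "\<rho> = r - 1"
  have r_eq: "r = \<rho> + 1" and \<rho>: "2 \<le> \<rho>" using r by (auto simp: \<rho>_def)
  interpret C: completed_algebraic_closure \<iota> by (rule C_inf)
  interpret D: drinfeld_point \<iota> ws \<rho> q
    by unfold_locales (use ws q in \<open>simp_all add: \<rho>_def\<close>)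
  have W: "D.W 1 = fps_const (inverse (Discr \<iota> ws)) * fps_X ^ (q ^ \<rho> - 1)"
    unfolding D.W_def D.\<Delta>_pow_1 by (simp add: D.\<Delta>_def)
  have S_T: "S_series \<iota> ws [:0, 1:] = 1 +
    (\<Sum>i=1..\<rho> - 1. fps_const (g_coeff \<iota> i ws / Discr \<iota> ws) * fps_X ^ (q ^ \<rho> - q ^ i)) +
    fps_const (A_emb \<iota> [:0, 1:] / Discr \<iota> ws) * fps_X ^ (q ^ \<rho> - 1)"
    using D.S_T_eq[OF \<rho>] by (simp only: D.\<Delta>_def)
  have geometric: "(\<lambda>k. (- (D.\<Pi>1 - 1)) ^ k) sums inverse D.\<Pi>1"
    using fps_geometric_sums[of "D.\<Pi>1 - 1"] D.\<Pi>1_nth_0 by simp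
  have nth: "fps_nth (P ws) n = fps_nth (fps_const (h' ws ^ q) * fps_X * inverse D.\<Pi>1) n"
    if "n < (q - 1) * (q ^ (2 * \<rho> + 1) - q ^ (\<rho> + 1)) + 1" for n
    by (rule D.limit_nth_eq[OF \<rho> _ that]) (use h_normalized ws in \<open>simp add: r_eq\<close>)
  have arith: "r - 1 = \<rho>" "r - 2 = \<rho> - 1" "2 * r - 1 = 2 * \<rho> + 1" by (simp_all add: r_eq)
  show "let g = (\<lambda>i. g_coeff \<iota> i ws);
        \<Delta>' = Discr \<iota> ws;
        T = A_emb \<iota> [:0, 1:];
        S\<^sub>T = 1 + (\<Sum>i=1..r-2. fps_const (g i / \<Delta>') * fps_X ^ (q ^ (r - 1) - q ^ i))
               + fps_const (T / \<Delta>') * fps_X ^ (q ^ (r - 1) - 1);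
        W = fps_const (inverse \<Delta>') * fps_X ^ (q ^ (r - 1) - 1);
        \<Pi>\<^sub>1 = S\<^sub>T ^ q - S\<^sub>T * W ^ (q - 1);
        U = \<Pi>\<^sub>1 - 1;
        N = (q - 1) * (q ^ (2 * r - 1) - q ^ r) + 1
    in S_series \<iota> ws [:0, 1:] = S\<^sub>T \<and>
       (\<lambda>k. (- U) ^ k) sums inverse \<Pi>\<^sub>1 \<and>
       (\<forall>n<N. fps_nth (P ws) n = fps_nth (fps_const (h' ws ^ q) * fps_X * inverse \<Pi>\<^sub>1) n)"
    unfolding Let_def arith S_T[symmetric] W[symmetric] D.\<Pi>1_def[symmetric]
    using geometric nth by (simp only: r_eq) blast
qed

end
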